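(* Let $\Omega$ be a Riemannian manifold, $T:\Omega\to\Omega$ a $C^{1+\alpha}$-map for some $\alpha>0$, and $\mu$ a $T$-invariant probability measure on $\Omega$. Assume there is a generating partition (finite or countably infinite) $\mathcal{A}$ of $\Omega$ such that: (i) $\mu$ is right $\phi$-mixing with respect to $\mathcal{A}$ with rate $\phi(k)$ decaying at least polynomially with power $p$, i.e. $\phi(k)=\mathcal{O}(k^{-p})$; (ii) $\operatorname{diam}\mathcal{A}^n$ decays polynomially fast with power $\varpi$ as $n\to\infty$, i.e. $\operatorname{diam}\mathcal{A}^n=\mathcal{O}(n^{-\varpi})$; (iii) there exists $w>1$ such that $\frac{\mu(B_{r+r^w}(x))}{\mu(B_r(x))}\to1$ as $r\to0^+$ for every $x$; (iv) there exists $d>0$ so that $\mu(B_r(x))=\mathcal{O}(r^d)$ for all $r>0$ small enough and all $x$. Assume $\frac{\varpi d}{w}>1$. For $x\in\Omega$, $r>0$ and $n=n(r)=\left[2^{1/\varpi}r^{-w/\varpi}\right]+1$, put $$U_n^-=\bigcup_{A\in\mathcal{A}^n:\,A\subset B_r(x)}A,\qquad U_n^+=\bigcup_{A\in\mathcal{A}^n:\,A\cap B_r(x)\neq\varnothing}A .$$ Assume that, for some $\zeta\in(0,1]$, each of the two neighbourhood systems $\{U_n\}=\{U_n^-\}$ and $\{U_n\}=\{U_n^+\}$ has the following property: if $x$ is periodic with minimal period $m$, then there exist $J(n)\in(0,1)$ with $J(n)\gtrsim n^{\zeta-1}$ (in particular $J(n)n\to\infty$) and $r_n\to0$ as $n\to\infty$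 so that $$\mu\Big(\bigcap_{j=0}^kT^{-i_j}U_n\Big)=\mu\Big(\bigcap_{j=0}^{i_k/m}T^{-jm}U_n\Big)(1+\mathcal{O}^*(r_n))$$ for all $k$ and all $0=i_0<i_1<\cdots<i_k$ that are multiples of $m$ and satisfy $i_k\le J(n)n$. If $p>\max\left\{\frac{2-\zeta}{\zeta},2\right\}$, then $$\rho(x)=\lim_{r\to0}\frac{\rho_{B_r(x)}}{\mu(B_r(x))}=\begin{cases}1&\text{if }x\text{ is non-periodic}\\1-\vartheta&\text{if }x\text{ is periodic}\end{cases}$$ for every $x\in\Omega$, provided, for $x$ periodic with minimal period $m$, that the limit $\vartheta=\lim_{r\to0}\frac{\mu(T^{-m}B_r(x)\cap B_r(x))}{\mu(B_r(x))}$ exists and satisfies $\vartheta<\frac12$.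
   Context: $\mathcal{A}^n=\bigvee_{j=0}^{n-1}T^{-j}\mathcal{A}$ is the $n$th join of the partition $\mathcal{A}$; its elements are called $n$-cylinders, and $A_n(x)\in\mathcal{A}^n$ is the $n$-cylinder containing $x$. $\mathcal{A}$ is generating if $\bigcap_nA_n(x)=\{x\}$ for every $x$. $\sigma(\mathcal{A}^n)$ is the $\sigma$-algebra generated by $n$-cylinders, and $\operatorname{diam}\mathcal{A}^n=\sup_{A\in\mathcal{A}^n}\operatorname{diam}A$. $\mu$ is right $\phi$-mixing with respect to $\mathcal{A}$ if $|\mu(A\cap T^{-n-k}B)-\mu(A)\mu(B)|\le\phi(k)\mu(B)$ for all $A\in\sigma(\mathcal{A}^n)$, $n\in\mathbb{N}$, and $B\in\sigma(\bigcup_j\mathcal{A}^j)$, where $\phi(k)$ is decreasing and converges to $0$ as $k\to\infty$. For $U\subset\Omega$, $\tau_U(x)=\inf\{j\ge1:T^jx\in U\}$ is the entry time and $\rho_U=\lim_{t\to\infty}\frac1t|\log\mu(\tau_U>t)|$ is the escape rate to $U$ (whenever the limit exists). $B_r(x)$ is the metric ball of radius $r$ centred at $x$; $[\cdot]$ is the integer part. $\mathcal{O}^*$ indicates an $\mathcal{O}$-term whose implied constant equals $1$. $a\gtrsim b$ means $b\le Ca$ for a constant $C$ independent of $n$. *)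

theory Defs
  imports "HOL-Probability.Probability" "HOL-Library.Landau_Symbols"
begin

section \<open>Riemannian manifolds\<close>

text \<open>
  The manifold is the whole type \<open>'a\<close>, modelled on the Euclidean space \<open>'b\<close>; being a second
  countable metric space it is second countable and Hausdorff. A chart is a domain together with
  a map that is meaningful on that domain only.
\<close>

type_synonym ('a, 'b) chart = "'a set \<times> ('a \<Rightarrow> 'b)"

text \<open>Continuous differentiability of order \<open>k\<close>, for open \<open>S\<close>, by iterated partial derivatives.\<close>

primrec C_k_on :: "nat \<Rightarrow> ('b::euclidean_space \<Rightarrow> 'c::real_normed_vector) \<Rightarrow> 'b set \<Rightarrow> bool" where
  "C_k_on 0 f S \<longleftrightarrow> continuous_on S f"
| "C_k_on (Suc k) f S \<longleftrightarrow>
     (\<forall>p\<in>S. f differentiable (at p)) \<and>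
     (\<forall>e\<in>Basis. C_k_on k (\<lambda>p. frechet_derivative f (at p) e) S)"

definition smooth_on :: "('b::euclidean_space \<Rightarrow> 'c::real_normed_vector) \<Rightarrow> 'b set \<Rightarrow> bool" where
  "smooth_on f S \<longleftrightarrow> (\<forall>k. C_k_on k f S)"

definition smooth_atlas ::
    "('a::{metric_space,second_countable_topology}, 'b::euclidean_space) chart set \<Rightarrow> bool" where
  "smooth_atlas charts \<longleftrightarrow>
     (\<Union>(U, \<phi>)\<in>charts. U) = UNIV \<and>
     (\<forall>(U, \<phi>)\<in>charts. open U \<and> open (\<phi> ` U) \<and> homeomorphism U (\<phi> ` U) \<phi> (inv_into U \<phi>)) \<and>
     (\<forall>(U, \<phi>)\<in>charts. \<forall>(V, \<psi>)\<in>charts. smooth_on (\<psi> \<circ> inv_into U \<phi>) (\<phi> ` (U \<inter> V)))"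

text \<open>
  A metric tensor in coordinates: \<open>g (U, \<phi>) x u v\<close> is the inner product of the tangent vectors at
  \<open>x \<in> U\<close> whose coordinates in the chart \<open>(U, \<phi>)\<close> are \<open>u\<close> and \<open>v\<close>. The last clause is the
  transformation law under a change of charts.
\<close>

definition riemannian_metric ::
    "('a::{metric_space,second_countable_topology}, 'b::euclidean_space) chart set
      \<Rightarrow> (('a, 'b) chart \<Rightarrow> 'a \<Rightarrow> 'b \<Rightarrow> 'b \<Rightarrow> real) \<Rightarrow> bool" where
  "riemannian_metric charts g \<longleftrightarrow>
     (\<forall>(U, \<phi>)\<in>charts.
        (\<forall>x\<in>U. bilinear (g (U, \<phi>) x) \<and>
               (\<forall>u v. g (U, \<phi>) x u v = g (U, \<phi>) x v u) \<and>
               (\<forall>u. u \<noteq> 0 \<longrightarrow> g (U, \<phi>) x u u > 0)) \<and>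
        (\<forall>u v. smooth_on (\<lambda>p. g (U, \<phi>) (inv_into U \<phi> p) u v) (\<phi> ` U))) \<and>
     (\<forall>(U, \<phi>)\<in>charts. \<forall>(V, \<psi>)\<in>charts. \<forall>x\<in>U \<inter> V. \<forall>u v.
        (let D = frechet_derivative (\<psi> \<circ> inv_into U \<phi>) (at (\<phi> x))
         in g (U, \<phi>) x u v = g (V, \<psi>) x (D u) (D v)))"

text \<open>
  The library's notion of a piecewise \<open>C\<^sup>1\<close> function does not ask for one-sided derivatives at the
  finitely many break points. This does not affect the infimum of lengths below, as the length of
  such a curve (possibly \<open>\<infinity>\<close>) is the limit of the lengths of \<open>C\<^sup>1\<close> curves on smaller intervals.
\<close>

definition piecewise_C1_curve ::
    "('a::{metric_space,second_countable_topology}, 'b::euclidean_space) chart set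
      \<Rightarrow> (real \<Rightarrow> 'a) \<Rightarrow> bool" where
  "piecewise_C1_curve charts \<gamma> \<longleftrightarrow>
     continuous_on {0..1} \<gamma> \<and>
     (\<forall>(U, \<phi>)\<in>charts. \<forall>a b. {a..b} \<subseteq> {0..1} \<and> \<gamma> ` {a..b} \<subseteq> U \<longrightarrow>
        (\<phi> \<circ> \<gamma>) piecewise_C1_differentiable_on {a..b})"

text \<open>By the transformation law the speed does not depend on the chart that is chosen.\<close>

definition curve_speed ::
    "('a::{metric_space,second_countable_topology}, 'b::euclidean_space) chart set
      \<Rightarrow> (('a, 'b) chart \<Rightarrow> 'a \<Rightarrow> 'b \<Rightarrow> 'b \<Rightarrow> real) \<Rightarrow> (real \<Rightarrow> 'a) \<Rightarrow> real \<Rightarrow> real" where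
  "curve_speed charts g \<gamma> t =
     (let (U, \<phi>) = (SOME c. c \<in> charts \<and> \<gamma> t \<in> fst c);
          v = vector_derivative (\<phi> \<circ> \<gamma>) (at t)
      in sqrt (g (U, \<phi>) (\<gamma> t) v v))"

definition curve_length ::
    "('a::{metric_space,second_countable_topology}, 'b::euclidean_space) chart set
      \<Rightarrow> (('a, 'b) chart \<Rightarrow> 'a \<Rightarrow> 'b \<Rightarrow> 'b \<Rightarrow> real) \<Rightarrow> (real \<Rightarrow> 'a) \<Rightarrow> ennreal" where
  "curve_length charts g \<gamma> = (\<integral>\<^sup>+t\<in>{0..1}. ennreal (curve_speed charts g \<gamma> t) \<partial>lborel)"

definition riemannian_distance ::
    "('a::{metric_space,second_countable_topology}, 'b::euclidean_space) chart set
      \<Rightarrow> (('a, 'b) chart \<Rightarrow> 'a \<Rightarrow> 'b \<Rightarrow> 'b \<Rightarrow> real) \<Rightarrow> 'a \<Rightarrow> 'a \<Rightarrow> ennreal" where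
  "riemannian_distance charts g x y =
     (INF \<gamma> \<in> {\<gamma>. piecewise_C1_curve charts \<gamma> \<and> \<gamma> 0 = x \<and> \<gamma> 1 = y}. curve_length charts g \<gamma>)"

text \<open>
  The distance of the type is the Riemannian distance. Connectedness is not required: points in
  different components have Riemannian distance \<open>\<infinity>\<close>, and there \<open>dist\<close> is only constrained by being
  a metric for the manifold topology.
\<close>

definition riemannian_manifold ::
    "('a::{metric_space,second_countable_topology}, 'b::euclidean_space) chart set
      \<Rightarrow> (('a, 'b) chart \<Rightarrow> 'a \<Rightarrow> 'b \<Rightarrow> 'b \<Rightarrow> real) \<Rightarrow> bool" where
  "riemannian_manifold charts g \<longleftrightarrow>
     smooth_atlas charts \<and> riemannian_metric charts g \<and>
     (\<forall>x y. riemannian_distance charts g x y < \<infinity> \<longrightarrow>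
        ennreal (dist x y) = riemannian_distance charts g x y)"

text \<open>
  \<open>C\<^sup>1\<^sup>+\<^sup>\<alpha>\<close> for \<open>0 < \<alpha> \<le> 1\<close>: in charts, the derivative is locally Hoelder continuous with
  exponent \<open>\<alpha>\<close>.
\<close>

definition C1_holder_map ::
    "('a::{metric_space,second_countable_topology}, 'b::euclidean_space) chart set
      \<Rightarrow> real \<Rightarrow> ('a \<Rightarrow> 'a) \<Rightarrow> bool" where
  "C1_holder_map charts \<alpha> T \<longleftrightarrow>
     continuous_on UNIV T \<and>
     (\<forall>(U, \<phi>)\<in>charts. \<forall>(V, \<psi>)\<in>charts. \<forall>x\<in>U. T x \<in> V \<longrightarrow>
        (\<exists>W (D :: 'b \<Rightarrow> 'b \<Rightarrow>\<^sub>L 'b) C.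
           open W \<and> \<phi> x \<in> W \<and> W \<subseteq> \<phi> ` (U \<inter> T -` V) \<and>
           (\<forall>p\<in>W. ((\<psi> \<circ> T \<circ> inv_into U \<phi>) has_derivative blinfun_apply (D p)) (at p)) \<and>
           (\<forall>p\<in>W. \<forall>q\<in>W. norm (D p - D q) \<le> C * dist p q powr \<alpha>)))"

section \<open>Partitions, cylinders and mixing\<close>

definition invariant_prob :: "'a::topological_space measure \<Rightarrow> ('a \<Rightarrow> 'a) \<Rightarrow> bool" where
  "invariant_prob M T \<longleftrightarrow>
     prob_space M \<and> sets M = sets borel \<and> T \<in> measurable M M \<and> distr M M T = M"

definition cylinders :: "('a \<Rightarrow> 'a) \<Rightarrow> 'a set set \<Rightarrow> nat \<Rightarrow> 'a set set" where
  "cylinders T P n =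
     {C. C \<noteq> {} \<and> (\<exists>A. (\<forall>j<n. A j \<in> P) \<and> C = (\<Inter>j\<in>{..<n}. (T ^^ j) -` A j))}"

definition cylinder_at :: "('a \<Rightarrow> 'a) \<Rightarrow> 'a set set \<Rightarrow> nat \<Rightarrow> 'a \<Rightarrow> 'a set" where
  "cylinder_at T P n x = (THE C. C \<in> cylinders T P n \<and> x \<in> C)"

definition generating_partition :: "'a measure \<Rightarrow> ('a \<Rightarrow> 'a) \<Rightarrow> 'a set set \<Rightarrow> bool" where
  "generating_partition M T P \<longleftrightarrow>
     countable P \<and> P \<subseteq> sets M \<and> partition_on UNIV P \<and>
     (\<forall>x. (\<Inter>n. cylinder_at T P n x) = {x})"

text \<open>Extended-valued, because the library's \<open>diameter\<close> is unspecified for unbounded sets.\<close>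

definition cylinders_diam :: "('a::metric_space \<Rightarrow> 'a) \<Rightarrow> 'a set set \<Rightarrow> nat \<Rightarrow> ennreal" where
  "cylinders_diam T P n =
     (SUP A \<in> cylinders T P n. SUP (x, y) \<in> A \<times> A. ennreal (dist x y))"

definition right_phi_mixing ::
    "'a measure \<Rightarrow> ('a \<Rightarrow> 'a) \<Rightarrow> 'a set set \<Rightarrow> (nat \<Rightarrow> real) \<Rightarrow> bool" where
  "right_phi_mixing M T P \<phi> \<longleftrightarrow>
     decseq \<phi> \<and> \<phi> \<longlonglongrightarrow> 0 \<and>
     (\<forall>n k. \<forall>A \<in> sigma_sets UNIV (cylinders T P n).
        \<forall>B \<in> sigma_sets UNIV (\<Union>j. cylinders T P j).
          \<bar>measure M (A \<inter> (T ^^ (n + k)) -` B) - measure M A * measure M B\<bar> \<le> \<phi> k * measure M B)"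

section \<open>Escape rates\<close>

definition entry_time :: "('a \<Rightarrow> 'a) \<Rightarrow> 'a set \<Rightarrow> 'a \<Rightarrow> enat" where
  "entry_time T U x = (INF j \<in> {j. 1 \<le> j \<and> (T ^^ j) x \<in> U}. enat j)"

text \<open>\<open>1/t |log \<mu>(\<tau>\<^sub>U > t)|\<close> with \<open>|log 0| = \<infinity>\<close>, whereas \<open>ln 0 = 0\<close> in the library.\<close>

definition escape_quotient ::
    "'a measure \<Rightarrow> ('a \<Rightarrow> 'a) \<Rightarrow> 'a set \<Rightarrow> nat \<Rightarrow> ereal" where
  "escape_quotient M T U t =
     (let p = measure M {x. entry_time T U x > enat t}
      in if p = 0 then \<infinity> else ereal (\<bar>ln p\<bar> / real t))"

definition escape_rate_exists :: "'a measure \<Rightarrow> ('a \<Rightarrow> 'a) \<Rightarrow> 'a set \<Rightarrow> bool" where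
  "escape_rate_exists M T U \<longleftrightarrow> (\<exists>\<rho>. escape_quotient M T U \<longlonglongrightarrow> \<rho>)"

definition escape_rate :: "'a measure \<Rightarrow> ('a \<Rightarrow> 'a) \<Rightarrow> 'a set \<Rightarrow> ereal" where
  "escape_rate M T U = lim (escape_quotient M T U)"

text \<open>
  The escape rate is defined only when the limit in \<open>t\<close> exists. The first clause is the limit of
  \<open>\<rho>\<^bsub>B\<^sub>r(x)\<^esub> / \<mu>(B\<^sub>r(x))\<close> over the radii for which it is defined; the other two make the same claim
  for the lower and upper escape rates and so keep content at all small radii.
\<close>

definition has_localised_escape_rate ::
    "'a::metric_space measure \<Rightarrow> ('a \<Rightarrow> 'a) \<Rightarrow> 'a \<Rightarrow> real \<Rightarrow> bool" where
  "has_localised_escape_rate M T x L \<longleftrightarrow>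
     ((\<lambda>r. escape_rate M T (ball x r) / ereal (measure M (ball x r))) \<longlongrightarrow> ereal L)
        (at 0 within {r. 0 < r \<and> escape_rate_exists M T (ball x r)}) \<and>
     ((\<lambda>r. liminf (escape_quotient M T (ball x r)) / ereal (measure M (ball x r))) \<longlongrightarrow> ereal L)
        (at_right 0) \<and>
     ((\<lambda>r. limsup (escape_quotient M T (ball x r)) / ereal (measure M (ball x r))) \<longlongrightarrow> ereal L)
        (at_right 0)"

section \<open>Periodic points and approximating neighbourhoods\<close>

definition minimal_period :: "('a \<Rightarrow> 'a) \<Rightarrow> 'a \<Rightarrow> nat \<Rightarrow> bool" where
  "minimal_period T x m \<longleftrightarrow>
     0 < m \<and> (T ^^ m) x = x \<and> (\<forall>j. 0 < j \<and> j < m \<longrightarrow> (T ^^ j) x \<noteq> x)"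

definition approx_order :: "real \<Rightarrow> real \<Rightarrow> real \<Rightarrow> nat" where
  "approx_order \<kappa> w r = nat \<lfloor>2 powr (1 / \<kappa>) * r powr (- w / \<kappa>)\<rfloor> + 1"

definition inner_approx ::
    "('a::metric_space \<Rightarrow> 'a) \<Rightarrow> 'a set set \<Rightarrow> nat \<Rightarrow> 'a \<Rightarrow> real \<Rightarrow> 'a set" where
  "inner_approx T P n x r = \<Union>{A \<in> cylinders T P n. A \<subseteq> ball x r}"

definition outer_approx ::
    "('a::metric_space \<Rightarrow> 'a) \<Rightarrow> 'a set set \<Rightarrow> nat \<Rightarrow> 'a \<Rightarrow> real \<Rightarrow> 'a set" where
  "outer_approx T P n x r = \<Union>{A \<in> cylinders T P n. A \<inter> ball x r \<noteq> {}}"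

text \<open>
  \<open>N r\<close> is the order belonging to the radius \<open>r\<close> and \<open>U r\<close> the neighbourhood built from
  \<open>N r\<close>-cylinders. Many radii share the same order; \<open>J\<close> and \<open>\<epsilon>\<close> depend on the order only.
\<close>

definition periodic_overlap_property ::
    "'a measure \<Rightarrow> ('a \<Rightarrow> 'a) \<Rightarrow> 'a \<Rightarrow> real \<Rightarrow> (real \<Rightarrow> nat) \<Rightarrow> (real \<Rightarrow> 'a set) \<Rightarrow> bool" where
  "periodic_overlap_property M T x \<zeta> N U \<longleftrightarrow>
     (\<forall>m. minimal_period T x m \<longrightarrow>
       (\<exists>(J :: nat \<Rightarrow> real) (\<epsilon> :: nat \<Rightarrow> real).
          (\<forall>n\<ge>1. 0 < J n \<and> J n < 1) \<and>
          (\<exists>C. \<forall>n\<ge>1. real n powr (\<zeta> - 1) \<le> C * J n) \<and>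
          \<epsilon> \<longlonglongrightarrow> 0 \<and>
          (\<forall>r>0. \<forall>k (i :: nat \<Rightarrow> nat).
             i 0 = 0 \<and> (\<forall>j<k. i j < i (Suc j)) \<and> (\<forall>j\<le>k. m dvd i j) \<and>
             real (i k) \<le> J (N r) * real (N r) \<longrightarrow>
             (\<exists>\<theta>. \<bar>\<theta>\<bar> \<le> \<bar>\<epsilon> (N r)\<bar> \<and>
                measure M (\<Inter>j\<in>{..k}. (T ^^ i j) -` U r) =
                measure M (\<Inter>j\<in>{..i k div m}. (T ^^ (j * m)) -` U r) * (1 + \<theta>)))))"

end

theory Submission
  imports Defs
begin

text \<open>
  Write \<open>u = \<mu>(U)\<close> for a small set \<open>U\<close> that is a union of \<open>N\<close>-cylinders, and \<open>a\<^sub>t\<close> for the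
  measure of the set of points that avoid \<open>U\<close> at the times \<open>0, \<dots>, t - 1\<close>; by invariance this is
  \<open>\<mu>(\<tau>\<^sub>U > t)\<close>. Choose a block length \<open>s\<close> and a gap \<open>g\<close>. Mixing across the gap makes the avoidance
  of \<open>U\<close> in successive blocks almost independent, so that \<open>a\<^sub>t\<close> decays by a factor close to \<open>a\<^sub>s\<close>
  in each block. From above, \<open>a\<^sub>t\<^sub>+\<^sub>s\<^sub>+\<^sub>N\<^sub>+\<^sub>g \<le> (a\<^sub>s + \<phi>(g)) a\<^sub>t\<close> (lemma
  \<open>prob_survivors_gap_le\<close>). From below, \<open>a\<^sub>t - a\<^sub>t\<^sub>+\<^sub>s \<le> (1 - a\<^sub>s + \<phi>(g)) a\<^sub>t\<^sub>-\<^sub>N\<^sub>-\<^sub>g\<close> (lemma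
  \<open>prob_survivors_diff_le\<close>), where \<open>a\<^sub>t\<^sub>-\<^sub>N\<^sub>-\<^sub>g\<close> is at most \<open>a\<^sub>t\<close> times a constant close to \<open>1\<close>.
  If \<open>N + g\<close> is small against \<open>s\<close>, and \<open>\<phi>(g)\<close> is small against \<open>s u\<close>, which itself tends to \<open>0\<close>,
  both the lower and the upper escape rate are \<open>(1 - a\<^sub>s) / s\<close> up to an error that is small against \<open>u\<close>.
  Such \<open>s\<close> and \<open>g\<close> exist once \<open>N u \<rightarrow> 0\<close> and \<open>\<phi>(k) = O(k\<^sup>-\<^sup>2)\<close> (lemma \<open>time_scales_exist\<close>).

  It remains to see that the hitting probability \<open>1 - a\<^sub>s\<close>, divided by \<open>s u\<close>, tends to \<open>1 - \<vartheta>\<close>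
  (lemma \<open>hitting_probability_asymptotics\<close>). Splitting according to the last visit to \<open>U\<close>, it is the sum
  over \<open>j < s\<close> of the measure of the points of \<open>U\<close> that do not return within the next \<open>j\<close> steps, so
  the question is which part of \<open>U\<close> returns before time \<open>s\<close>. Three ranges of return times occur.
  For return times between a large constant \<open>K\<close> and \<open>2 N\<close>, replace \<open>U\<close> by the union of the cylinders
  that meet it and whose order is half the return time; mixing and \<open>\<mu>(B\<^sub>r) = O(r\<^sup>d)\<close> then bound
  the proportion that returns by the tail of a convergent series, plus a term that vanishes because
  \<open>N r\<^sup>d \<rightarrow> 0\<close>. From \<open>2 N\<close> on, mixing applies to \<open>U\<close> itself and the proportion that returns is at most
  \<open>s u\<close> plus such a tail (lemma \<open>long_returns\<close>); convergence and \<open>N r\<^sup>d \<rightarrow> 0\<close> are where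
  \<open>\<kappa> d / w > 1\<close> and \<open>w > 1\<close> enter. A return time below \<open>K\<close> that is not a period of the centre
  is excluded by continuity once the radius is small. For a return time below \<open>K\<close> that is a multiple
  of the period \<open>m\<close>, the overlap hypothesis says that nearly all of the returning part of \<open>U\<close> already
  returns at time \<open>m\<close> (lemma \<open>short_returns_periodic\<close>). Hence the proportion of \<open>U\<close> that returns is
  \<open>0\<close> in the limit for a non-periodic centre and \<open>\<vartheta>\<close> for a periodic one.

  Finally a ball lies between its inner and outer cylinder approximations, whose measures
  are asymptotic to that of the ball by the annulus hypothesis, and escape quotients are monotone
  in the set.
\<close>

section \<open>Sets determined by finitely many symbols\<close>

text \<open>For a partition, these are the unions of \<open>n\<close>-cylinders (lemma \<open>observable_eq_Union_cylinders\<close>). Stated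
  through itineraries, the property passes to complements and survivor sets without any
  manipulation of countable unions.\<close>

definition observable :: "('a \<Rightarrow> 'a) \<Rightarrow> 'a set set \<Rightarrow> nat \<Rightarrow> 'a set \<Rightarrow> bool" where
  "observable T P n S \<longleftrightarrow>
     (\<forall>x y. (\<forall>j<n. \<forall>A\<in>P. (T ^^ j) x \<in> A \<longleftrightarrow> (T ^^ j) y \<in> A) \<longrightarrow> (x \<in> S \<longleftrightarrow> y \<in> S))"

lemma observableD:
  assumes "observable T P n S" "\<And>j A. j < n \<Longrightarrow> A \<in> P \<Longrightarrow> (T ^^ j) x \<in> A \<longleftrightarrow> (T ^^ j) y \<in> A"
  shows "x \<in> S \<longleftrightarrow> y \<in> S"
  using assms unfolding observable_def by blast

lemma observable_Compl:
  "observable T P n S \<Longrightarrow> observable T P n (- S)"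
  unfolding observable_def by blast

lemma cylindersE:
  assumes "C \<in> cylinders T P n"
  obtains A where "C \<noteq> {}" "\<And>j. j < n \<Longrightarrow> A j \<in> P" "C = (\<Inter>j\<in>{..<n}. (T ^^ j) -` A j)"
proof -
  have "C \<noteq> {}" "\<exists>A. (\<forall>j<n. A j \<in> P) \<and> C = (\<Inter>j\<in>{..<n}. (T ^^ j) -` A j)"
    using assms unfolding cylinders_def mem_Collect_eq by simp_all
  then show thesis using that by metis
qed

lemma observable_Union_cylinders:
  assumes "\<C> \<subseteq> cylinders T P n"
  shows "observable T P n (\<Union>\<C>)"
proof -
  have *: "y \<in> \<Union>\<C>"
    if same: "\<forall>j<n. \<forall>A\<in>P. (T ^^ j) x \<in> A \<longleftrightarrow> (T ^^ j) y \<in> A" and "x \<in> \<Union>\<C>" for x y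
  proof -
    from that obtain C where C: "C \<in> \<C>" "x \<in> C" by blast
    then obtain A where A: "\<forall>j<n. A j \<in> P" "C = (\<Inter>j\<in>{..<n}. (T ^^ j) -` A j)"
      using assms unfolding cylinders_def by blast
    have "y \<in> C" using C(2) A same by auto
    with C(1) show ?thesis by blast
  qed
  show ?thesis unfolding observable_def
  proof (intro allI impI)
    fix x y
    assume same: "\<forall>j<n. \<forall>A\<in>P. (T ^^ j) x \<in> A \<longleftrightarrow> (T ^^ j) y \<in> A"
    then have same': "\<forall>j<n. \<forall>A\<in>P. (T ^^ j) y \<in> A \<longleftrightarrow> (T ^^ j) x \<in> A" by simp
    show "x \<in> \<Union>\<C> \<longleftrightarrow> y \<in> \<Union>\<C>" using *[OF same] *[OF same'] by (rule iffI)
  qed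
qed

text \<open>Unlike the entry time, this counts from time \<open>0\<close>. The measure is the same, and orbit pieces
  concatenate without an offset.\<close>

definition survivors :: "('a \<Rightarrow> 'a) \<Rightarrow> 'a set \<Rightarrow> nat \<Rightarrow> 'a set" where
  "survivors T U t = {x. \<forall>j<t. (T ^^ j) x \<notin> U}"

lemma survivors_0 [simp]: "survivors T U 0 = UNIV"
  by (simp add: survivors_def)

lemma survivors_add:
  "survivors T U (s + t) = survivors T U s \<inter> (T ^^ s) -` survivors T U t" (is "?L = ?R")
proof
  show "?L \<subseteq> ?R"
  proof
    fix x assume x: "x \<in> ?L"
    have "(T ^^ j) ((T ^^ s) x) \<notin> U" if "j < t" for j
    proof -
      have "(T ^^ (j + s)) x \<notin> U" using x that by (simp add: survivors_def)
      then show ?thesis by (simp add: funpow_add)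
    qed
    then show "x \<in> ?R" using x by (simp add: survivors_def)
  qed
  show "?R \<subseteq> ?L"
  proof
    fix x assume x: "x \<in> ?R"
    have "(T ^^ j) x \<notin> U" if "j < s + t" for j
    proof (cases "j < s")
      case True then show ?thesis using x by (auto simp: survivors_def)
    next
      case False
      then have "(T ^^ (j - s)) ((T ^^ s) x) \<notin> U" using x that by (auto simp: survivors_def)
      moreover have "(T ^^ (j - s)) ((T ^^ s) x) = (T ^^ j) x"
        using False by (metis comp_apply funpow_add le_add_diff_inverse2 not_less)
      ultimately show ?thesis by simp
    qed
    then show "x \<in> ?L" by (simp add: survivors_def)
  qed
qed

lemma survivors_antimono: "s \<le> t \<Longrightarrow> survivors T U t \<subseteq> survivors T U s"
  by (auto simp: survivors_def)

lemma survivors_mono_set: "U \<subseteq> V \<Longrightarrow> survivors T V t \<subseteq> survivors T U t"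
  by (auto simp: survivors_def)

lemma observable_survivors:
  assumes "observable T P n U"
  shows "observable T P (t + n) (survivors T U t)"
  unfolding observable_def
proof (intro allI impI)
  fix x y
  assume same: "\<forall>i<t + n. \<forall>A\<in>P. ((T ^^ i) x \<in> A) = ((T ^^ i) y \<in> A)"
  have "(T ^^ j) x \<in> U \<longleftrightarrow> (T ^^ j) y \<in> U" if "j < t" for j
  proof (rule observableD[OF assms])
    fix i A assume "i < n" "A \<in> P"
    then show "((T ^^ i) ((T ^^ j) x) \<in> A) = ((T ^^ i) ((T ^^ j) y) \<in> A)"
      using same[rule_format, of "i + j" A] that by (simp add: funpow_add)
  qed
  then show "(x \<in> survivors T U t) = (y \<in> survivors T U t)" by (auto simp: survivors_def)
qed

lemma entry_time_gt_iff:
  "entry_time T U x > enat t \<longleftrightarrow> T x \<in> survivors T U t"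
proof -
  have "entry_time T U x > enat t \<longleftrightarrow> (\<forall>j\<in>{j. 1 \<le> j \<and> (T ^^ j) x \<in> U}. t < j)"
  proof -
    have "entry_time T U x > enat t \<longleftrightarrow> entry_time T U x \<ge> enat (Suc t)"
      by (simp add: Suc_ile_eq)
    also have "\<dots> \<longleftrightarrow> (\<forall>j\<in>{j. 1 \<le> j \<and> (T ^^ j) x \<in> U}. enat (Suc t) \<le> enat j)"
      unfolding entry_time_def by (rule le_INF_iff)
    finally show ?thesis by (simp add: Suc_le_eq)
  qed
  also have "\<dots> \<longleftrightarrow> (\<forall>j<t. (T ^^ j) (T x) \<notin> U)"
  proof (intro iffI allI impI ballI)
    fix j assume "\<forall>j\<in>{j. 1 \<le> j \<and> (T ^^ j) x \<in> U}. t < j" "j < t"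
    then show "(T ^^ j) (T x) \<notin> U" 
      by (metis (no_types, lifting) Suc_leI funpow_Suc_right comp_apply le_add1 mem_Collect_eq not_less plus_1_eq_Suc)
  next
    fix j assume H: "\<forall>j<t. (T ^^ j) (T x) \<notin> U" and "j \<in> {j. 1 \<le> j \<and> (T ^^ j) x \<in> U}"
    then have j: "1 \<le> j" "(T ^^ j) x \<in> U" by auto
    show "t < j"
    proof (rule ccontr)
      assume "\<not> t < j"
      with j(1) obtain i where "j = Suc i" "i < t" by (cases j) auto
      with j H show False by (simp add: funpow_swap1)
    qed
  qed
  finally show ?thesis by (simp add: survivors_def)
qed

locale mixing_system =
  fixes M :: "'a::topological_space measure" and T :: "'a \<Rightarrow> 'a"
    and P :: "'a set set" and \<phi> :: "nat \<Rightarrow> real"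
  assumes invariant: "invariant_prob M T"
    and partition: "countable P" "P \<subseteq> sets M" "partition_on UNIV P"
    and mixing: "right_phi_mixing M T P \<phi>"
begin

sublocale prob_space M
  using invariant by (simp add: invariant_prob_def)

lemma space_UNIV [simp]: "space M = UNIV"
  using invariant by (metis invariant_prob_def sets_eq_imp_space_eq space_borel)

lemma measurable_T [measurable]: "T \<in> measurable M M"
  using invariant by (simp add: invariant_prob_def)

lemma measurable_funpow [measurable]: "(T ^^ k) \<in> measurable M M"
proof (induction k)
  case (Suc k)
  then show ?case using measurable_comp[OF Suc.IH measurable_T] by simp
qed simp

lemma sets_vimage_funpow [measurable]: "S \<in> sets M \<Longrightarrow> (T ^^ k) -` S \<in> sets M"
  using measurable_sets[OF measurable_funpow, of S k] by simp

lemma measure_vimage_T: "S \<in> sets M \<Longrightarrow> prob (T -` S) = prob S"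
  using invariant measure_distr[OF measurable_T, of S] by (simp add: invariant_prob_def)

lemma measure_vimage_funpow:
  "S \<in> sets M \<Longrightarrow> prob ((T ^^ k) -` S) = prob S"
proof (induction k)
  case (Suc k)
  have "(T ^^ Suc k) -` S = T -` ((T ^^ k) -` S)"
    by (auto simp: funpow_swap1)
  then show ?case
    using Suc measure_vimage_T[OF sets_vimage_funpow[OF Suc.prems, of k]] by metis
qed simp

lemma phi_nonneg: "\<phi> k \<ge> 0"
  using mixing decseq_ge unfolding right_phi_mixing_def by blast

lemma phi_antimono: "k \<le> l \<Longrightarrow> \<phi> l \<le> \<phi> k"
proof -
  have "decseq \<phi>" using mixing unfolding right_phi_mixing_def by simp
  then show "k \<le> l \<Longrightarrow> \<phi> l \<le> \<phi> k" by (rule decseqD)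
qed

lemma cylinder_through:
  obtains C where "C \<in> cylinders T P n" "x \<in> C"
proof -
  have "\<exists>A\<in>P. (T ^^ j) x \<in> A" for j
    using partition(3) by (auto simp: partition_on_def)
  then obtain A where A: "\<And>j. A j \<in> P" "\<And>j. (T ^^ j) x \<in> A j" by metis
  have x: "x \<in> (\<Inter>j\<in>{..<n}. (T ^^ j) -` A j)" using A(2) by auto
  have "(\<Inter>j\<in>{..<n}. (T ^^ j) -` A j) \<in> cylinders T P n"
    unfolding cylinders_def mem_Collect_eq
    by (intro conjI exI[of _ A] allI impI refl A(1)) (use x in \<open>rule ex_in_conv[THEN iffD1, OF exI]\<close>)
  then show thesis using x by (rule that)
qed

lemma countable_cylinders: "countable (cylinders T P n)"
proof (induction n)
  case 0
  have "cylinders T P 0 \<subseteq> {UNIV}" by (auto simp: cylinders_def)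
  then show ?case by (rule countable_subset) simp
next
  case (Suc n)
  have "cylinders T P (Suc n) \<subseteq> (\<lambda>(C, A). C \<inter> (T ^^ n) -` A) ` (cylinders T P n \<times> P)"
  proof
    fix C assume "C \<in> cylinders T P (Suc n)"
    obtain A where A: "C \<noteq> {}" "\<And>j. j < Suc n \<Longrightarrow> A j \<in> P"
        "C = (\<Inter>j\<in>{..<Suc n}. (T ^^ j) -` A j)"
      using cylindersE[OF \<open>C \<in> cylinders T P (Suc n)\<close>] by metis
    define C' where "C' = (\<Inter>j\<in>{..<n}. (T ^^ j) -` A j)"
    have C: "C = C' \<inter> (T ^^ n) -` A n"
      unfolding A(3) C'_def lessThan_Suc by blast
    have "C' \<noteq> {}" using A(1) C by blast
    then have "C' \<in> cylinders T P n"
      unfolding cylinders_def C'_def mem_Collect_eq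
      by (intro conjI exI[of _ A] allI impI refl) (use A(2) in \<open>simp_all add: less_SucI\<close>)
    then show "C \<in> (\<lambda>(C, A). C \<inter> (T ^^ n) -` A) ` (cylinders T P n \<times> P)"
      using A(2) C by (intro image_eqI[of _ _ "(C', A n)"]) simp_all
  qed
  then show ?case
    by (rule countable_subset) (intro countable_image countable_SIGMA Suc partition(1))
qed

lemma sets_cylinder:
  assumes "C \<in> cylinders T P n"
  shows "C \<in> sets M"
proof -
  obtain A where A: "\<forall>j<n. A j \<in> P" "C = (\<Inter>j\<in>{..<n}. (T ^^ j) -` A j)"
    using assms unfolding cylinders_def by blast
  show ?thesis
  proof (cases "n = 0")
    case True then show ?thesis using A sets.top[of M] by simp
  next
    case False
    then show ?thesis unfolding A(2) using A(1) partition(2)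
      by (intro sets.finite_INT) (auto intro!: sets_vimage_funpow)
  qed
qed

lemma observable_eq_Union_cylinders:
  assumes "observable T P n S"
  shows "S = \<Union>{C \<in> cylinders T P n. C \<subseteq> S}"
proof -
  have "\<exists>C\<in>cylinders T P n. x \<in> C \<and> C \<subseteq> S" if "x \<in> S" for x
  proof -
    obtain C where C: "C \<in> cylinders T P n" "x \<in> C" by (rule cylinder_through)
    then obtain A where A: "\<forall>j<n. A j \<in> P" "C = (\<Inter>j\<in>{..<n}. (T ^^ j) -` A j)"
      unfolding cylinders_def by blast
    have "y \<in> S" if "y \<in> C" for y
    proof -
      have "(T ^^ j) x \<in> B \<longleftrightarrow> (T ^^ j) y \<in> B" if "j < n" "B \<in> P" for j B
      proof -
        have "(T ^^ j) x \<in> A j" "(T ^^ j) y \<in> A j" using C(2) \<open>y \<in> C\<close> A(2) that by auto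
        moreover have "A j \<in> P" using A(1) that by simp
        \<comment> \<open>partition elements that share a point coincide\<close>
        ultimately show ?thesis
          using partition(3) that(2) unfolding partition_on_def disjoint_def by blast
      qed
      then show ?thesis using observableD[OF assms] \<open>x \<in> S\<close> by blast
    qed
    with C show ?thesis by blast
  qed
  then show ?thesis by blast
qed

text \<open>The partition is countable, hence so is the family of \<open>n\<close>-cylinders, and every union of them is a
  countable one.\<close>

lemma sigma_sets_observable:
  assumes "observable T P n S"
  shows "S \<in> sigma_sets UNIV (cylinders T P n)"
proof -
  have "\<Union>{C \<in> cylinders T P n. C \<subseteq> S} \<in> sigma_sets UNIV (cylinders T P n)"
    by (rule sigma_sets_UNION) (auto intro: countable_subset[OF _ countable_cylinders[of n]])
  then show ?thesis using observable_eq_Union_cylinders[OF assms] by simp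
qed

lemma sets_observable:
  assumes "observable T P n S"
  shows "S \<in> sets M"
proof -
  have "\<Union>{C \<in> cylinders T P n. C \<subseteq> S} \<in> sets M"
    by (rule sets.countable_Union)
      (auto intro: countable_subset[OF _ countable_cylinders[of n]] sets_cylinder)
  then show ?thesis using observable_eq_Union_cylinders[OF assms] by simp
qed

lemma mixing_observable:
  assumes A: "observable T P l A" and B: "observable T P n B" and q: "l + k = q"
  shows "\<bar>prob (A \<inter> (T ^^ q) -` B) - prob A * prob B\<bar> \<le> \<phi> k * prob B"
proof -
  have "B \<in> sigma_sets UNIV (\<Union>j. cylinders T P j)"
    using sigma_sets_observable[OF B] sigma_sets_mono'[of "cylinders T P n"] by blast
  then show ?thesis
    using mixing sigma_sets_observable[OF A] q unfolding right_phi_mixing_def by blast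
qed

lemma mixing_observable_le:
  assumes "observable T P l A" "observable T P n B" "l + k = q"
  shows "prob (A \<inter> (T ^^ q) -` B) \<le> (prob A + \<phi> k) * prob B"
  using mixing_observable[OF assms] by (simp add: distrib_right)

end

section \<open>Decay of the survivor sets\<close>

context mixing_system
begin

lemma sets_survivors [measurable]: "U \<in> sets M \<Longrightarrow> survivors T U t \<in> sets M"
proof (induction t)
  case 0
  then show ?case using sets.top[of M] by simp
next
  case (Suc t)
  have "survivors T U 1 = space M - U" by (auto simp: survivors_def)
  then have "survivors T U 1 \<in> sets M" using Suc.prems by (simp only: sets.compl_sets)
  then show ?case using Suc survivors_add[of T U 1 t] sets_vimage_funpow by (metis plus_1_eq_Suc sets.Int)
qed

lemma prob_entry_time_gt:
  assumes "U \<in> sets M"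
  shows "prob {x. entry_time T U x > enat t} = prob (survivors T U t)"
proof -
  have "{x. entry_time T U x > enat t} = T -` survivors T U t"
    by (auto simp: entry_time_gt_iff)
  then show ?thesis using measure_vimage_T sets_survivors[OF assms] by simp
qed

lemma prob_survivors_antimono:
  "U \<in> sets M \<Longrightarrow> s \<le> t \<Longrightarrow> prob (survivors T U t) \<le> prob (survivors T U s)"
  by (intro finite_measure_mono survivors_antimono sets_survivors)

lemma prob_UNIV [simp]: "prob UNIV = 1"
  using prob_space by simp

text \<open>Surviving for \<open>t + (s + N + g)\<close> steps entails surviving the first \<open>s\<close> steps, an event that depends on
  \<open>s + N\<close> symbols, and surviving \<open>t\<close> steps after a gap of length \<open>g\<close>.\<close>

lemma prob_survivors_gap_le:
  assumes U: "observable T P N U"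
  shows "prob (survivors T U (t + (s + N + g))) \<le> (prob (survivors T U s) + \<phi> g) * prob (survivors T U t)"
proof -
  note [measurable] = sets_observable[OF U]
  have "survivors T U (t + (s + N + g)) = survivors T U ((s + N + g) + t)" by (simp add: add.commute)
  also have "\<dots> \<subseteq> survivors T U s \<inter> (T ^^ (s + N + g)) -` survivors T U t"
    unfolding survivors_add[of T U "s + N + g" t]
    using survivors_antimono[of s "s + N + g" T U] by auto
  finally have "prob (survivors T U (t + (s + N + g)))
      \<le> prob (survivors T U s \<inter> (T ^^ (s + N + g)) -` survivors T U t)"
    by (intro finite_measure_mono) measurable
  also have "\<dots> \<le> (prob (survivors T U s) + \<phi> g) * prob (survivors T U t)"
    by (rule mixing_observable_le[OF observable_survivors[OF U] observable_survivors[OF U]]) simp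
  finally show ?thesis .
qed

text \<open>A point counted on the left hits \<open>U\<close> in the first \<open>s\<close> steps and then survives \<open>t\<close> steps. Forgetting the
  first \<open>N + g\<close> of these \<open>t\<close> steps opens the gap that mixing needs, at the price of \<open>t - (N + g)\<close> in place
  of \<open>t\<close> on the right.\<close>

lemma prob_survivors_diff_le:
  assumes U: "observable T P N U"
  shows "prob (survivors T U t) - prob (survivors T U (t + s))
     \<le> (1 - prob (survivors T U s) + \<phi> g) * prob (survivors T U (t - (N + g)))"
proof -
  note [measurable] = sets_observable[OF U]
  let ?W = "survivors T U"
  have split: "?W (t + s) = ?W s \<inter> (T ^^ s) -` ?W t"
    using survivors_add[of T U s t] by (simp add: add.commute)
  have compl: "prob (- ?W s) = 1 - prob (?W s)"
    using prob_compl[of "?W s"] by (simp add: Compl_eq_Diff_UNIV)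
  have [measurable]: "- ?W s \<in> sets M"
    using sets.compl_sets[of "?W s" M] by (simp add: Compl_eq_Diff_UNIV)
  have "prob (?W t) - prob (?W (t + s)) = prob ((T ^^ s) -` ?W t) - prob (?W s \<inter> (T ^^ s) -` ?W t)"
    unfolding split by (simp add: measure_vimage_funpow)
  also have "\<dots> = prob ((T ^^ s) -` ?W t - ?W s \<inter> (T ^^ s) -` ?W t)"
    by (intro finite_measure_Diff[symmetric]) auto
  also have "(T ^^ s) -` ?W t - ?W s \<inter> (T ^^ s) -` ?W t = - ?W s \<inter> (T ^^ s) -` ?W t" by blast
  also have "prob \<dots> \<le> (1 - prob (?W s) + \<phi> g) * prob (?W (t - (N + g)))"
  proof (cases "t \<ge> N + g")
    case True
    have "?W t = ?W ((N + g) + (t - (N + g)))" using True by simp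
    also have "\<dots> \<subseteq> (T ^^ (N + g)) -` ?W (t - (N + g))" by (subst survivors_add) blast
    finally have sub: "?W t \<subseteq> (T ^^ (N + g)) -` ?W (t - (N + g))" .
    have "- ?W s \<inter> (T ^^ s) -` ?W t \<subseteq> - ?W s \<inter> (T ^^ (s + N + g)) -` ?W (t - (N + g))"
    proof
      fix x assume x: "x \<in> - ?W s \<inter> (T ^^ s) -` ?W t"
      then have "(T ^^ (N + g)) ((T ^^ s) x) \<in> ?W (t - (N + g))" using sub by blast
      moreover have "(T ^^ (N + g)) ((T ^^ s) x) = (T ^^ (s + N + g)) x"
        by (metis add.assoc add.commute comp_apply funpow_add)
      ultimately show "x \<in> - ?W s \<inter> (T ^^ (s + N + g)) -` ?W (t - (N + g))" using x by simp
    qed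
    then have "prob (- ?W s \<inter> (T ^^ s) -` ?W t) 
        \<le> prob (- ?W s \<inter> (T ^^ (s + N + g)) -` ?W (t - (N + g)))"
      by (intro finite_measure_mono) measurable
    also have "\<dots> \<le> (prob (- ?W s) + \<phi> g) * prob (?W (t - (N + g)))"
      by (rule mixing_observable_le[OF observable_Compl[OF observable_survivors[OF U]]
            observable_survivors[OF U]]) simp
    finally show ?thesis by (simp add: compl)
  next
    case False
    \<comment> \<open>the truncated difference is \<open>0\<close>, where the survivor set is the whole space\<close>
    have "prob (- ?W s \<inter> (T ^^ s) -` ?W t) \<le> prob (- ?W s)"
      by (intro finite_measure_mono) auto
    then show ?thesis using False phi_nonneg[of g] by (simp add: compl)
  qed
  finally show ?thesis .
qed

text \<open>Decomposition by the last visit to \<open>U\<close> before time \<open>s\<close>: by invariance, a last visit that is followed by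
  \<open>j\<close> steps outside \<open>U\<close> has the measure of \<open>U \<inter> T -` survivors T U j\<close>.\<close>

lemma prob_hit_eq_sum:
  assumes [measurable]: "U \<in> sets M"
  shows "1 - prob (survivors T U s) = (\<Sum>j<s. prob (U \<inter> T -` survivors T U j))"
proof (induction s)
  case (Suc s)
  let ?W = "survivors T U"
  have meas: "T -` ?W s \<in> sets M" using sets_vimage_funpow[of "?W s" 1] by simp
  have "?W (Suc s) = T -` ?W s - U \<inter> T -` ?W s"
    using survivors_add[of T U 1 s] by (auto simp: survivors_def)
  then have "prob (?W (Suc s)) = prob (T -` ?W s) - prob (U \<inter> T -` ?W s)"
    using meas by (simp add: finite_measure_Diff sets.Int)
  also have "prob (T -` ?W s) = prob (?W s)" by (simp add: measure_vimage_T)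
  finally show ?case using Suc by simp
qed simp

lemma prob_hit_le:
  assumes [measurable]: "U \<in> sets M"
  shows "1 - prob (survivors T U s) \<le> real s * prob U"
proof -
  have "(\<Sum>j<s. prob (U \<inter> T -` survivors T U j)) \<le> (\<Sum>j<s. prob U)"
    by (intro sum_mono finite_measure_mono) auto
  then show ?thesis by (simp add: prob_hit_eq_sum)
qed

text \<open>From \<open>j = m\<close> on, a point that does not return within \<open>j\<close> steps does not return at time \<open>m\<close>.\<close>

lemma prob_hit_le_return:
  assumes U [measurable]: "U \<in> sets M" and m: "m \<ge> 1"
  shows "1 - prob (survivors T U s)
     \<le> real m * prob U + real s * (prob U - prob (U \<inter> (T ^^ m) -` U))"
proof -
  let ?r = "prob (U \<inter> (T ^^ m) -` U)"
  have "prob (U \<inter> T -` survivors T U j) \<le> (prob U - ?r) + (if j < m then prob U else 0)" for j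
  proof (cases "j < m")
    case True
    have "prob (U \<inter> T -` survivors T U j) \<le> prob U" "?r \<le> prob U"
      by (intro finite_measure_mono; auto)+
    then show ?thesis using True by simp
  next
    case False
    have "x \<notin> (T ^^ m) -` U" if "T x \<in> survivors T U j" for x
    proof -
      have "(T ^^ (m - 1)) (T x) \<notin> U" using that False m by (simp add: survivors_def)
      moreover have "(T ^^ (m - 1)) (T x) = (T ^^ m) x" using m by (cases m) (auto simp: funpow_swap1)
      ultimately show ?thesis by simp
    qed
    then have "prob (U \<inter> T -` survivors T U j) \<le> prob (U - U \<inter> (T ^^ m) -` U)"
      by (intro finite_measure_mono) auto
    also have "\<dots> = prob U - ?r" by (intro finite_measure_Diff) auto
    finally show ?thesis using False by simp
  qed
  then have "(\<Sum>j<s. prob (U \<inter> T -` survivors T U j))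
      \<le> (\<Sum>j<s. (prob U - ?r) + (if j < m then prob U else 0))"
    by (intro sum_mono)
  also have "\<dots> = real s * (prob U - ?r) + (\<Sum>j<s. if j < m then prob U else 0)"
    by (simp add: sum.distrib)
  also have "(\<Sum>j<s. if j < m then prob U else 0) = (\<Sum>j\<in>{..<s} \<inter> {j. j < m}. prob U)"
    by (simp add: sum.If_cases)
  also have "\<dots> = real (card ({..<s} \<inter> {j. j < m})) * prob U" by simp
  also have "\<dots> \<le> real m * prob U"
    using card_mono[of "{..<m}" "{..<s} \<inter> {j. j < m}"]
    by (intro mult_right_mono) (auto simp: lessThan_def)
  finally show ?thesis by (simp add: prob_hit_eq_sum)
qed

text \<open>The points of \<open>U\<close> that do return before time \<open>s\<close> are covered by those that return at time \<open>m\<close>, those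
  that miss the time \<open>m\<close> but return before \<open>K\<close>, and those that return at time \<open>K\<close> or later.\<close>

lemma prob_hit_ge_return:
  assumes U [measurable]: "U \<in> sets M"
  shows "1 - prob (survivors T U s) \<ge> real s * (prob U - prob (U \<inter> (T ^^ m) -` U)
      - (\<Sum>i\<in>{1..<K}. prob (U \<inter> (T ^^ i) -` U - (T ^^ m) -` U))
      - (\<Sum>i\<in>{K..<s}. prob (U \<inter> (T ^^ i) -` U)))" (is "_ \<ge> real s * ?x")
proof -
  have "?x \<le> prob (U \<inter> T -` survivors T U j)" if "j < s" for j
  proof -
    let ?S = "U \<inter> T -` survivors T U j"
    let ?A = "\<Union>i\<in>{1..<K}. U \<inter> (T ^^ i) -` U - (T ^^ m) -` U"
    let ?B = "\<Union>i\<in>{K..<s}. U \<inter> (T ^^ i) -` U"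
    have [measurable]: "T -` survivors T U j \<in> sets M"
      using sets_vimage_funpow[of "survivors T U j" 1] by simp
    have [measurable]: "?A \<in> sets M" "?B \<in> sets M"
      by (intro sets.finite_UN; auto)+
    have "U \<subseteq> (?S \<union> (U \<inter> (T ^^ m) -` U)) \<union> (?A \<union> ?B)"
    proof
      fix x assume x: "x \<in> U"
      show "x \<in> (?S \<union> (U \<inter> (T ^^ m) -` U)) \<union> (?A \<union> ?B)"
      proof (cases "T x \<in> survivors T U j")
        case False
        then obtain i where i: "i < j" "(T ^^ i) (T x) \<in> U" by (auto simp: survivors_def)
        then have iU: "Suc i < s" "(T ^^ Suc i) x \<in> U" using that by (auto simp: funpow_swap1)
        show ?thesis
        proof (cases "Suc i < K")
          case True
          then have "Suc i \<in> {1..<K}" by simp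
          with iU x show ?thesis by blast
        next
          case False
          then have "Suc i \<in> {K..<s}" using iU by simp
          with iU x show ?thesis by blast
        qed
      qed (use x in blast)
    qed
    then have "prob U \<le> prob ((?S \<union> (U \<inter> (T ^^ m) -` U)) \<union> (?A \<union> ?B))"
      by (intro finite_measure_mono) auto
    also have "\<dots> \<le> prob (?S \<union> (U \<inter> (T ^^ m) -` U)) + prob (?A \<union> ?B)"
      by (intro measure_Un_le) auto
    also have "prob (?S \<union> (U \<inter> (T ^^ m) -` U)) \<le> prob ?S + prob (U \<inter> (T ^^ m) -` U)"
      by (intro measure_Un_le) auto
    also have "prob (?A \<union> ?B) \<le> prob ?A + prob ?B"
      by (intro measure_Un_le) auto
    also have "prob ?A \<le> (\<Sum>i\<in>{1..<K}. prob (U \<inter> (T ^^ i) -` U - (T ^^ m) -` U))"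
      by (intro finite_measure_subadditive_finite) auto
    also have "prob ?B \<le> (\<Sum>i\<in>{K..<s}. prob (U \<inter> (T ^^ i) -` U))"
      by (intro finite_measure_subadditive_finite) auto
    finally show ?thesis by simp
  qed
  then have "(\<Sum>j<s. ?x) \<le> (\<Sum>j<s. prob (U \<inter> T -` survivors T U j))"
    by (intro sum_mono) auto
  then show ?thesis by (simp add: prob_hit_eq_sum)
qed

text \<open>A point of \<open>D \<inter> (T ^^ m) -` D\<close> outside \<open>C \<inter> (T ^^ m) -` C\<close> has either itself or its image
  in \<open>D - C\<close>.\<close>

lemma return_prob_diff:
  assumes [measurable]: "C \<in> sets M" "D \<in> sets M" and sub: "C \<subseteq> D"
  shows "\<bar>prob (D \<inter> (T ^^ m) -` D) - prob (C \<inter> (T ^^ m) -` C)\<bar> \<le> 2 * (prob D - prob C)"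
proof -
  have "prob (C \<inter> (T ^^ m) -` C) \<le> prob (D \<inter> (T ^^ m) -` D)"
    using sub by (intro finite_measure_mono) auto
  moreover have "prob (D \<inter> (T ^^ m) -` D) \<le> prob (C \<inter> (T ^^ m) -` C) + 2 * (prob D - prob C)"
  proof -
    have "prob (D \<inter> (T ^^ m) -` D) \<le> prob (C \<inter> (T ^^ m) -` C \<union> ((D - C) \<union> (T ^^ m) -` (D - C)))"
      by (intro finite_measure_mono) auto
    also have "\<dots> \<le> prob (C \<inter> (T ^^ m) -` C) + prob ((D - C) \<union> (T ^^ m) -` (D - C))"
      by (intro measure_Un_le) auto
    also have "prob ((D - C) \<union> (T ^^ m) -` (D - C)) \<le> prob (D - C) + prob ((T ^^ m) -` (D - C))"
      by (intro measure_Un_le) auto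
    also have "prob ((T ^^ m) -` (D - C)) = prob (D - C)" by (intro measure_vimage_funpow) auto
    also have "prob (D - C) = prob D - prob C" using sub by (intro finite_measure_Diff) auto
    finally show ?thesis by simp
  qed
  ultimately show ?thesis by simp
qed

text \<open>Removing one gap from the waiting time changes the survival probability by a factor close to \<open>1\<close>,
  uniformly in \<open>t\<close>. This makes the shift of time in \<open>prob_survivors_diff_le\<close> harmless. The induction needs
  the crude factor \<open>2\<close> at the previous step only, and improves it to the stated one.\<close>

lemma prob_survivors_delay:
  assumes U: "observable T P N U" and N: "N \<ge> 1"
    and small: "real (N + g) * prob U + \<phi> g \<le> 1 / 4" (is "?\<delta> \<le> _")
  shows "prob (survivors T U (t - (N + g))) * (1 - 2 * (real (N + g) * prob U + \<phi> g))
     \<le> prob (survivors T U t)"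
proof (induction t rule: less_induct)
  case (less t)
  let ?a = "\<lambda>t. prob (survivors T U t)" and ?D = "N + g"
  have hit: "1 - ?a s \<le> real s * prob U" for s
    by (rule prob_hit_le[OF sets_observable[OF U]])
  have d0: "?\<delta> \<ge> 0" using phi_nonneg[of g] by (simp add: add_nonneg_nonneg)
  show ?case
  proof (cases "t < ?D")
    case True
    then have "real t * prob U \<le> real ?D * prob U" by (intro mult_right_mono) auto
    then have "1 - ?a t \<le> ?\<delta>" using hit[of t] phi_nonneg[of g] by linarith
    then show ?thesis using True d0 by simp
  next
    case False
    let ?t = "t - ?D"
    have "?a ?t - ?a (?t + ?D) \<le> (1 - ?a ?D + \<phi> g) * ?a (?t - ?D)"
      by (rule prob_survivors_diff_le[OF U])
    also have "\<dots> \<le> ?\<delta> * ?a (?t - ?D)"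
      using hit[of ?D] by (intro mult_right_mono) auto
    also have "\<dots> \<le> ?\<delta> * (2 * ?a ?t)"
    proof (intro mult_left_mono d0)
      have "?a (?t - ?D) * (1 / 2) \<le> ?a (?t - ?D) * (1 - 2 * ?\<delta>)"
        using small by (intro mult_left_mono) auto
      also have "\<dots> \<le> ?a ?t" using less[of ?t] False N by simp
      finally show "?a (?t - ?D) \<le> 2 * ?a ?t" by simp
    qed
    finally have "?a ?t - ?a t \<le> ?\<delta> * (2 * ?a ?t)" using False by simp
    then show ?thesis by (simp add: algebra_simps)
  qed
qed

text \<open>Iterating the recursion gives \<open>\<mu>(\<tau>\<^sub>U > t) \<le> \<rho>\<^sup>k\<close> with \<open>k = t div L\<close>, and \<open>- ln \<rho> \<ge> 1 - \<rho>\<close>.\<close>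

lemma liminf_escape_quotient_ge:
  assumes U: "U \<in> sets M" and L: "L > 0"
    and rec: "\<And>t. prob (survivors T U (t + L)) \<le> \<rho> * prob (survivors T U t)"
  shows "ereal ((1 - \<rho>) / real L) \<le> liminf (escape_quotient M T U)"
proof -
  let ?a = "\<lambda>t. prob (survivors T U t)"
  let ?g = "\<lambda>t. (1 - \<rho>) * (1 / real L - 1 / real t)"
  have rho0: "\<rho> \<ge> 0" using order_trans[OF measure_nonneg rec[of 0]] by simp
  have pow: "?a (k * L) \<le> \<rho> ^ k" for k
  proof (induction k)
    case (Suc k)
    have "?a (Suc k * L) \<le> \<rho> * ?a (k * L)" using rec[of "k * L"] by (simp add: add.commute)
    also have "\<dots> \<le> \<rho> * \<rho> ^ k" using Suc rho0 by (intro mult_left_mono)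
    finally show ?case by simp
  qed (simp add: prob_space)
  have "ereal (?g t) \<le> escape_quotient M T U t" if t: "t \<ge> L" for t
  proof (cases "?a t = 0")
    case True
    then show ?thesis by (simp add: escape_quotient_def prob_entry_time_gt[OF U])
  next
    case False
    then have pos: "?a t > 0" by (simp add: zero_less_measure_iff)
    have le1: "?a t \<le> 1" by simp
    have t0: "real t > 0" "1 / real L \<ge> 1 / real t" using t L by (auto simp: frac_le)
    have "?g t * real t \<le> - ln (?a t)"
    proof (cases "\<rho> \<le> 1")
      case False
      then have "?g t * real t \<le> 0"
        using t0 by (intro mult_nonpos_nonneg) (auto simp: mult_le_0_iff)
      also have "\<dots> \<le> - ln (?a t)" using pos le1 by simp
      finally show ?thesis .
    next
      case True
      define k where "k = t div L"
      have "?a t \<le> ?a (k * L)" by (intro prob_survivors_antimono[OF U]) (simp add: k_def)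
      also note pow
      finally have at: "?a t \<le> \<rho> ^ k" .
      have "k \<ge> 1" using t L by (simp add: k_def Suc_le_eq div_greater_zero_iff)
      then have rpos: "\<rho> > 0" using at pos rho0 by (cases "\<rho> = 0") (auto simp: power_0_left)
      have "t < L * Suc k" using dividend_less_times_div[OF L, of t] by (simp add: k_def)
      then have "real t < real L * (real k + 1)" 
        by (metis of_nat_Suc of_nat_less_iff of_nat_mult add.commute)
      then have k: "real t / real L - 1 \<le> real k" using L by (simp add: field_simps)
      have "?g t * real t = (1 - \<rho>) * (real t / real L - 1)" using t0 by (simp add: field_simps)
      also have "\<dots> \<le> (1 - \<rho>) * real k" using k True by (intro mult_left_mono) auto
      also have "\<dots> \<le> (- ln \<rho>) * real k"
        using ln_le_minus_one[OF rpos] by (intro mult_right_mono) auto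
      also have "\<dots> = - ln (\<rho> ^ k)" using rpos by (simp add: ln_realpow)
      also have "\<dots> \<le> - ln (?a t)" using at pos rpos by simp
      finally show ?thesis .
    qed
    then have "?g t * real t \<le> \<bar>ln (?a t)\<bar>" using pos le1 by linarith
    then have "?g t \<le> \<bar>ln (?a t)\<bar> / real t"
      using t0 by (subst pos_le_divide_eq) auto
    then show ?thesis using False by (simp add: escape_quotient_def prob_entry_time_gt[OF U])
  qed
  then have "liminf (\<lambda>t. ereal (?g t)) \<le> liminf (escape_quotient M T U)"
    by (intro Liminf_mono eventually_sequentiallyI[of L])
  moreover have "(\<lambda>t. ereal (?g t)) \<longlonglongrightarrow> ereal ((1 - \<rho>) * (1 / real L - 0))"
    by (intro tendsto_intros lim_1_over_n) 
  then have "liminf (\<lambda>t. ereal (?g t)) = ereal ((1 - \<rho>) * (1 / real L - 0))"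
    by (intro lim_imp_Liminf) auto
  ultimately show ?thesis by simp
qed

text \<open>Iterating the recursion gives \<open>\<mu>(\<tau>\<^sub>U > t) \<ge> c\<^sup>k\<close> with \<open>k = t div s + 1\<close>, and \<open>- ln c \<le> 1 / c - 1\<close>.\<close>

lemma limsup_escape_quotient_le:
  assumes U: "U \<in> sets M" and s: "s > 0" and c: "0 < c" "c \<le> 1"
    and rec: "\<And>t. c * prob (survivors T U t) \<le> prob (survivors T U (t + s))"
  shows "limsup (escape_quotient M T U) \<le> ereal ((1 - c) / (c * real s))"
proof -
  let ?a = "\<lambda>t. prob (survivors T U t)"
  let ?g = "\<lambda>t. (1 - c) / c * (1 / real s + 1 / real t)"
  have pow: "c ^ k \<le> ?a (k * s)" for k
  proof (induction k)
    case (Suc k)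
    have "c ^ Suc k \<le> c * ?a (k * s)" using Suc c by simp
    also have "\<dots> \<le> ?a (Suc k * s)" using rec[of "k * s"] by (simp add: add.commute)
    finally show ?case .
  qed (simp add: prob_space)
  have "escape_quotient M T U t \<le> ereal (?g t)" if t: "t \<ge> 1" for t
  proof -
    define k where "k = Suc (t div s)"
    have "t \<le> k * s"
      unfolding k_def using dividend_less_times_div[OF s, of t] by (simp add: mult.commute less_imp_le)
    then have "c ^ k \<le> ?a t" using pow[of k] prob_survivors_antimono[OF U] by (meson order_trans)
    moreover have "c ^ k > 0" using c by simp
    ultimately have at: "c ^ k \<le> ?a t" "?a t > 0" by auto
    have le1: "?a t \<le> 1" by simp
    have "real (t div s) \<le> real t / real s" by (rule of_nat_div_le_of_nat)
    then have k: "real k \<le> real t / real s + 1" by (simp add: k_def)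
    have "- ln (?a t) \<le> - ln (c ^ k)" using at c by simp
    also have "\<dots> = real k * ln (1 / c)" using c by (simp add: ln_realpow ln_div)
    also have "\<dots> \<le> real k * (1 / c - 1)"
      using ln_le_minus_one[of "1 / c"] c by (intro mult_left_mono) auto
    also have "\<dots> \<le> (real t / real s + 1) * (1 / c - 1)"
      using k c by (intro mult_right_mono) (auto simp: field_simps)
    also have "\<dots> = ?g t * real t" using t c s by (simp add: field_simps)
    finally have "\<bar>ln (?a t)\<bar> \<le> ?g t * real t" using at le1 by simp
    then have "\<bar>ln (?a t)\<bar> / real t \<le> ?g t"
      using t by (subst pos_divide_le_eq) auto
    then show ?thesis using at by (simp add: escape_quotient_def prob_entry_time_gt[OF U])
  qed
  then have "limsup (escape_quotient M T U) \<le> limsup (\<lambda>t. ereal (?g t))"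
    by (intro Limsup_mono eventually_sequentiallyI[of 1])
  moreover have "(\<lambda>t. ereal (?g t)) \<longlonglongrightarrow> ereal ((1 - c) / c * (1 / real s + 0))"
    by (intro tendsto_intros lim_1_over_n)
  then have "limsup (\<lambda>t. ereal (?g t)) = ereal ((1 - c) / c * (1 / real s + 0))"
    by (intro lim_imp_Limsup) auto
  ultimately show ?thesis by simp
qed

end

section \<open>Escape rates of shrinking sets\<close>

context mixing_system
begin

text \<open>After division by \<open>s u\<close>, the bounds \<open>prob_hit_le_return\<close> and \<open>prob_hit_ge_return\<close> differ from \<open>1 - \<theta>\<close> by the
  contributions \<open>m / s\<close> of the first \<open>m\<close> summands, of the short returns that miss the time \<open>m\<close> (finitely
  many terms, each vanishing in the limit), and of the returns from time \<open>K\<close> on, which are at most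
  \<open>\<epsilon> + s u\<close> for suitable \<open>K\<close>.\<close>

lemma hitting_probability_asymptotics:
  fixes F :: "'i filter" and U :: "'i \<Rightarrow> 'a set" and s :: "'i \<Rightarrow> nat"
  assumes U: "\<And>i. U i \<in> sets M" and m: "m \<ge> 1"
    and pos: "eventually (\<lambda>i. prob (U i) > 0) F"
    and ret: "((\<lambda>i. prob (U i \<inter> (T ^^ m) -` U i) / prob (U i)) \<longlongrightarrow> \<theta>) F"
    and short: "\<And>j. j \<ge> 1 \<Longrightarrow>
      ((\<lambda>i. prob (U i \<inter> (T ^^ j) -` U i - (T ^^ m) -` U i) / prob (U i)) \<longlongrightarrow> 0) F"
    and long: "\<And>\<epsilon>. \<epsilon> > 0 \<Longrightarrow> \<exists>K. eventually (\<lambda>i. \<forall>s. (\<Sum>j\<in>{K..<s}. prob (U i \<inter> (T ^^ j) -` U i))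
      \<le> (\<epsilon> + real s * prob (U i)) * prob (U i)) F"
    and s_pos: "eventually (\<lambda>i. s i > 0) F"
    and s_large: "((\<lambda>i. 1 / real (s i)) \<longlongrightarrow> 0) F"
    and s_small: "((\<lambda>i. real (s i) * prob (U i)) \<longlongrightarrow> 0) F"
  shows "((\<lambda>i. (1 - prob (survivors T (U i) (s i))) / (real (s i) * prob (U i))) \<longlongrightarrow> 1 - \<theta>) F"
proof -
  define u where "u i = prob (U i)" for i
  define \<theta>' where "\<theta>' i = prob (U i \<inter> (T ^^ m) -` U i) / u i" for i
  define \<beta> where "\<beta> j i = prob (U i \<inter> (T ^^ j) -` U i - (T ^^ m) -` U i) / u i" for j i
  define X where "X i = (1 - prob (survivors T (U i) (s i))) / (real (s i) * u i)" for i
  have "((\<lambda>i. X i - (1 - \<theta>' i)) \<longlongrightarrow> 0) F"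
  proof (rule tendstoI)
    fix \<epsilon> :: real assume e: "\<epsilon> > 0"
    obtain K where K: "eventually (\<lambda>i. \<forall>s. (\<Sum>j\<in>{K..<s}. prob (U i \<inter> (T ^^ j) -` U i))
        \<le> (\<epsilon> / 2 + real s * u i) * u i) F"
      using long[of "\<epsilon> / 2"] e unfolding u_def by auto
    have "((\<lambda>i. real m * (1 / real (s i)) + ((\<Sum>j\<in>{1..<K}. \<beta> j i) + (\<epsilon> / 2 + real (s i) * u i)))
        \<longlongrightarrow> real m * 0 + ((\<Sum>j\<in>{1..<K}. 0) + (\<epsilon> / 2 + 0))) F"
      unfolding \<beta>_def u_def by (intro tendsto_intros short s_large s_small) auto
    then have "eventually (\<lambda>i. real m * (1 / real (s i)) +
        ((\<Sum>j\<in>{1..<K}. \<beta> j i) + (\<epsilon> / 2 + real (s i) * u i)) < \<epsilon>) F"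
      by (rule order_tendstoD(2)) (use e in simp)
    then show "eventually (\<lambda>i. dist (X i - (1 - \<theta>' i)) 0 < \<epsilon>) F"
      using K pos s_pos
    proof eventually_elim
      case (elim i)
      define S where "S = real (s i)"
      have up: "u i > 0" and sp: "S > 0" using elim by (auto simp: u_def S_def)
      have r: "prob (U i \<inter> (T ^^ m) -` U i) = \<theta>' i * u i" using up by (simp add: \<theta>'_def)
      have b: "(\<Sum>j\<in>{1..<K}. prob (U i \<inter> (T ^^ j) -` U i - (T ^^ m) -` U i)) = (\<Sum>j\<in>{1..<K}. \<beta> j i) * u i"
        unfolding sum_distrib_right using up by (simp add: \<beta>_def)
      have X: "1 - prob (survivors T (U i) (s i)) = X i * (S * u i)" using up sp by (simp add: X_def S_def)
      have "X i * (S * u i) \<le> real m * u i + S * (u i - \<theta>' i * u i)"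
        using prob_hit_le_return[OF U[of i] m, of "s i"] unfolding X r u_def[symmetric] S_def[symmetric] .
      also have "\<dots> = (real m * (1 / S) + (1 - \<theta>' i)) * (S * u i)" using sp by (simp add: field_simps)
      finally have upper: "X i \<le> real m * (1 / S) + (1 - \<theta>' i)"
        using up sp by (simp add: mult_le_cancel_right)
      have "(1 - \<theta>' i - (\<Sum>j\<in>{1..<K}. \<beta> j i) - (\<epsilon> / 2 + S * u i)) * (S * u i)
          = S * (u i - \<theta>' i * u i - (\<Sum>j\<in>{1..<K}. \<beta> j i) * u i - (\<epsilon> / 2 + S * u i) * u i)"
        by (simp add: algebra_simps)
      also have "\<dots> \<le> S * (u i - \<theta>' i * u i - (\<Sum>j\<in>{1..<K}. \<beta> j i) * u i
          - (\<Sum>j\<in>{K..<s i}. prob (U i \<inter> (T ^^ j) -` U i)))"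
        using elim(2)[rule_format, of "s i"] sp by (intro mult_left_mono) (auto simp: S_def)
      also have "\<dots> \<le> X i * (S * u i)"
        using prob_hit_ge_return[OF U[of i], where s = "s i" and m = m and K = K]
        unfolding X r b u_def[symmetric] S_def[symmetric] .
      finally have lower: "1 - \<theta>' i - (\<Sum>j\<in>{1..<K}. \<beta> j i) - (\<epsilon> / 2 + S * u i) \<le> X i"
        using up sp by (simp add: mult_le_cancel_right)
      have "(\<Sum>j\<in>{1..<K}. \<beta> j i) \<ge> 0" by (intro sum_nonneg) (simp add: \<beta>_def u_def)
      moreover have "real m * (1 / S) \<ge> 0" "S * u i \<ge> 0" using sp up by simp_all
      ultimately have "\<bar>X i - (1 - \<theta>' i)\<bar> < \<epsilon>"
        using lower upper elim(1) e unfolding S_def[symmetric] by linarith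
      then show ?case by simp
    qed
  qed
  moreover have "((\<lambda>i. 1 - \<theta>' i) \<longlongrightarrow> 1 - \<theta>) F"
    using ret unfolding \<theta>'_def u_def by (intro tendsto_intros)
  ultimately have "((\<lambda>i. (X i - (1 - \<theta>' i)) + (1 - \<theta>' i)) \<longlongrightarrow> 0 + (1 - \<theta>)) F"
    by (rule tendsto_add)
  then show ?thesis by (simp add: X_def u_def)
qed

text \<open>With \<open>v = N u\<close> and \<open>h = v\<^sup>1\<^sup>/\<^sup>4\<close>, the block length \<open>h / u\<close> and the gap \<open>h\<^sup>2 / u\<close> work: the block covers the
  small measure \<open>s u \<approx> h\<close>, the delay is \<open>(N + g) / s \<approx> v / h + h\<close>, and the mixing error satisfies
  \<open>\<phi>(g) / (s u) = O(u\<^sup>2 / h\<^sup>5)\<close>, which tends to \<open>0\<close> because \<open>h\<^sup>5 = v\<^sup>5\<^sup>/\<^sup>4\<close> and \<open>u \<le> v\<close>. The scales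
  are tied to \<open>u\<close> rather than to \<open>N\<close> because \<open>u\<close> may be smaller than every power of \<open>1 / N\<close>.\<close>

lemma time_scales_exist:
  fixes F :: "'i filter" and u :: "'i \<Rightarrow> real" and N :: "'i \<Rightarrow> nat"
  assumes N: "\<And>i. N i \<ge> 1"
    and pos: "eventually (\<lambda>i. u i > 0) F"
    and small: "((\<lambda>i. real (N i) * u i) \<longlongrightarrow> 0) F"
    and phi: "\<And>k. k \<ge> 1 \<Longrightarrow> \<phi> k \<le> C / (real k)\<^sup>2"
  obtains s g :: "'i \<Rightarrow> nat"
  where "eventually (\<lambda>i. s i > 0) F"
    and "((\<lambda>i. real (s i) * u i) \<longlongrightarrow> 0) F"
    and "((\<lambda>i. real (N i + g i) / real (s i)) \<longlongrightarrow> 0) F"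
    and "((\<lambda>i. \<phi> (g i) / (real (s i) * u i)) \<longlongrightarrow> 0) F"
proof -
  define v where "v i = real (N i) * u i" for i
  define h where "h i = v i powr (1 / 4)" for i
  define s where "s i = nat \<lceil>h i / u i\<rceil>" for i
  define g where "g i = nat \<lceil>(h i)\<^sup>2 / u i\<rceil>" for i
  have "v = (\<lambda>i. real (N i) * u i)" by (rule ext) (simp add: v_def)
  then have v0: "(v \<longlongrightarrow> 0) F" using small by simp
  have v_pos: "eventually (\<lambda>i. v i > 0) F" using pos
    by eventually_elim (use N in \<open>auto simp: v_def intro!: mult_pos_pos simp: Suc_le_eq\<close>)
  have v_powr: "((\<lambda>i. v i powr a) \<longlongrightarrow> 0) F" if "a > 0" for a
    using v0 by (rule tendsto_zero_powrI[OF _ tendsto_const]) 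
      (use that v_pos in \<open>auto elim: eventually_mono\<close>)
  have C0: "C \<ge> 0" using order_trans[OF phi_nonneg phi[of 1]] by simp
  have main: "eventually (\<lambda>i. s i > 0 \<and> real (s i) * u i \<le> v i powr (1/4) + v i
      \<and> real (N i + g i) / real (s i) \<le> 2 * v i powr (3/4) + v i powr (1/4)
      \<and> \<phi> (g i) / (real (s i) * u i) \<le> C * v i powr (3/4)) F"
    using pos v_pos
  proof eventually_elim
    case (elim i)
    have u: "u i > 0" and v: "v i > 0" by fact+
    have uv: "u i \<le> v i" using N[of i] u by (simp add: v_def)
    have h: "h i > 0" using v by (simp add: h_def)
    have "h i powr 4 = v i" using v by (simp add: h_def powr_powr)
    then have h4: "(h i) ^ 4 = v i" using h by simp
    have "v i / h i = v i powr 1 / v i powr (1/4)" using v by (simp add: h_def)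
    also have "\<dots> = v i powr (1 - 1/4)" by (rule powr_diff[symmetric])
    finally have vh: "v i / h i = v i powr (3/4)" by simp
    have s_ge: "real (s i) \<ge> h i / u i" unfolding s_def by (rule real_nat_ceiling_ge)
    have "real (s i) \<le> h i / u i + 1" using h u by (simp add: s_def)
    then have "real (s i) * u i \<le> (h i / u i + 1) * u i" using u by (intro mult_right_mono) auto
    also have "\<dots> = h i + u i" using u by (simp add: field_simps)
    finally have su: "real (s i) * u i \<le> h i + v i" using uv by simp
    have su': "real (s i) * u i \<ge> h i" using s_ge u by (simp add: field_simps)
    have s0: "real (s i) > 0" using s_ge h u by (meson divide_pos_pos less_le_trans)
    have g_ge: "real (g i) \<ge> (h i)\<^sup>2 / u i" unfolding g_def by (rule real_nat_ceiling_ge)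
    have "(h i)\<^sup>2 / u i > 0" using h u by simp
    then have g1: "g i \<ge> 1" using g_ge by linarith
    have "real (g i) \<le> (h i)\<^sup>2 / u i + 1" using h u by (simp add: g_def)
    then have "real (N i + g i) / real (s i) \<le> (real (N i) + ((h i)\<^sup>2 / u i + 1)) / real (s i)"
      using s0 by (intro divide_right_mono) auto
    also have "\<dots> \<le> (real (N i) + ((h i)\<^sup>2 / u i + 1)) / (h i / u i)"
      using s_ge h u by (intro divide_left_mono) (auto intro!: add_nonneg_nonneg mult_pos_pos divide_pos_pos s0)
    also have "\<dots> = v i / h i + h i + u i / h i"
      using h u by (simp add: v_def field_simps power2_eq_square)
    also have "\<dots> \<le> v i / h i + h i + v i / h i"
      using uv h by (intro add_left_mono divide_right_mono) auto
    finally have Ds: "real (N i + g i) / real (s i) \<le> 2 * (v i / h i) + h i" by simp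
    have "\<phi> (g i) \<le> C / (real (g i))\<^sup>2" by (rule phi[OF g1])
    also have "\<dots> \<le> C / ((h i)\<^sup>2 / u i)\<^sup>2"
      using g_ge g1 h u C0 by (intro divide_left_mono power_mono) (auto intro!: mult_pos_pos zero_less_power divide_pos_pos)
    also have "\<dots> = C * (u i)\<^sup>2 / v i"
      using h u v h4 by (simp add: field_simps)
    also have "\<dots> \<le> C * (v i)\<^sup>2 / v i"
      using uv u v C0 by (intro divide_right_mono mult_left_mono power_mono) auto
    also have "\<dots> = C * v i" using v by (simp add: power2_eq_square)
    finally have phig: "\<phi> (g i) \<le> C * v i" .
    have "\<phi> (g i) / (real (s i) * u i) \<le> C * v i / (real (s i) * u i)"
      using phig s0 u by (intro divide_right_mono) auto
    also have "\<dots> \<le> C * v i / h i"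
      using su' h s0 u C0 v by (intro divide_left_mono) auto
    finally have "\<phi> (g i) / (real (s i) * u i) \<le> C * (v i / h i)" by simp
    then have "\<phi> (g i) / (real (s i) * u i) \<le> C * v i powr (3/4)" unfolding vh .
    moreover have "real (N i + g i) / real (s i) \<le> 2 * v i powr (3/4) + v i powr (1/4)"
      using Ds unfolding vh unfolding h_def .
    ultimately show ?case using s0 su unfolding h_def by simp
  qed
  have lim1: "((\<lambda>i. v i powr (1/4) + v i) \<longlongrightarrow> 0) F"
    using tendsto_add[OF v_powr[of "1/4"] v0] by simp
  have lim2: "((\<lambda>i. 2 * v i powr (3/4) + v i powr (1/4)) \<longlongrightarrow> 0) F"
    using tendsto_add[OF tendsto_mult[OF tendsto_const[of 2] v_powr[of "3/4"]] v_powr[of "1/4"]] by simp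
  have lim3: "((\<lambda>i. C * v i powr (3/4)) \<longlongrightarrow> 0) F"
    using tendsto_mult[OF tendsto_const[of C] v_powr[of "3/4"]] by simp
  show thesis
  proof (rule that[of s g])
    show "eventually (\<lambda>i. s i > 0) F" using main by eventually_elim simp
    show "((\<lambda>i. real (s i) * u i) \<longlongrightarrow> 0) F"
      by (rule tendsto_sandwich[OF _ _ tendsto_const lim1])
        (use main pos in \<open>eventually_elim, simp\<close>)+
    show "((\<lambda>i. real (N i + g i) / real (s i)) \<longlongrightarrow> 0) F"
      by (rule tendsto_sandwich[OF _ _ tendsto_const lim2])
        (use main pos in \<open>eventually_elim, simp\<close>)+
    show "((\<lambda>i. \<phi> (g i) / (real (s i) * u i)) \<longlongrightarrow> 0) F"
      by (rule tendsto_sandwich[OF _ _ tendsto_const lim3])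
        (use main pos in \<open>eventually_elim, simp add: phi_nonneg\<close>)+
  qed
qed

text \<open>The abstract form of the result, for any sets that shrink along a filter. Its hypotheses on returns
  separate the one return time \<open>m\<close> that may carry positive proportion in the limit, the other fixed return times, and the
  tail. Sets that shrink to a non-periodic point are covered by \<open>m = 1\<close> and \<open>\<theta> = 0\<close>.\<close>

proposition escape_rate_asymptotics:
  fixes F :: "'i filter" and U :: "'i \<Rightarrow> 'a set" and N :: "'i \<Rightarrow> nat"
  assumes obs: "\<And>i. observable T P (N i) (U i)" and N: "\<And>i. N i \<ge> 1" and m: "m \<ge> 1"
    and pos: "eventually (\<lambda>i. prob (U i) > 0) F"
    and small: "((\<lambda>i. real (N i) * prob (U i)) \<longlongrightarrow> 0) F"
    and phi: "\<And>k. k \<ge> 1 \<Longrightarrow> \<phi> k \<le> C / (real k)\<^sup>2"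
    and ret: "((\<lambda>i. prob (U i \<inter> (T ^^ m) -` U i) / prob (U i)) \<longlongrightarrow> \<theta>) F"
    and short: "\<And>j. j \<ge> 1 \<Longrightarrow>
      ((\<lambda>i. prob (U i \<inter> (T ^^ j) -` U i - (T ^^ m) -` U i) / prob (U i)) \<longlongrightarrow> 0) F"
    and long: "\<And>\<epsilon>. \<epsilon> > 0 \<Longrightarrow> \<exists>K. eventually (\<lambda>i. \<forall>s. (\<Sum>j\<in>{K..<s}. prob (U i \<inter> (T ^^ j) -` U i))
      \<le> (\<epsilon> + real s * prob (U i)) * prob (U i)) F"
  obtains lo hi :: "'i \<Rightarrow> real"
  where "eventually (\<lambda>i. ereal (lo i) \<le> liminf (escape_quotient M T (U i))) F"
    and "((\<lambda>i. lo i / prob (U i)) \<longlongrightarrow> 1 - \<theta>) F"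
    and "eventually (\<lambda>i. limsup (escape_quotient M T (U i)) \<le> ereal (hi i)) F"
    and "((\<lambda>i. hi i / prob (U i)) \<longlongrightarrow> 1 - \<theta>) F"
proof -
  note U = sets_observable[OF obs]
  define u where "u i = prob (U i)" for i
  obtain s g where s_pos: "eventually (\<lambda>i. s i > 0) F"
    and su: "((\<lambda>i. real (s i) * u i) \<longlongrightarrow> 0) F"
    and Ds: "((\<lambda>i. real (N i + g i) / real (s i)) \<longlongrightarrow> 0) F"
    and fsu: "((\<lambda>i. \<phi> (g i) / (real (s i) * u i)) \<longlongrightarrow> 0) F"
    by (rule time_scales_exist[OF N pos small phi, folded u_def])
  have s_large: "((\<lambda>i. 1 / real (s i)) \<longlongrightarrow> 0) F"
  proof (rule tendsto_sandwich[OF _ _ tendsto_const Ds])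
    show "eventually (\<lambda>i. 1 / real (s i) \<le> real (N i + g i) / real (s i)) F"
    proof (intro always_eventually allI divide_right_mono)
      fix i show "1 \<le> real (N i + g i)" using N[of i] by simp
    qed simp
  qed simp
  define X where "X i = (1 - prob (survivors T (U i) (s i))) / (real (s i) * u i)" for i
  define Y where "Y i = \<phi> (g i) / (real (s i) * u i)" for i
  define D where "D i = real (N i + g i)" for i
  define b where "b i = 1 / (1 - 2 * (D i * u i + \<phi> (g i)))" for i
  define q where "q i = (1 - prob (survivors T (U i) (s i)) + \<phi> (g i)) * b i" for i
  define lo where "lo i = (1 - (prob (survivors T (U i) (s i)) + \<phi> (g i))) / real (s i + N i + g i)" for i
  define hi where "hi i = q i / ((1 - q i) * real (s i))" for i
  have X_eq: "X = (\<lambda>i. (1 - prob (survivors T (U i) (s i))) / (real (s i) * prob (U i)))"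
    by (rule ext) (simp add: X_def u_def)
  have X: "(X \<longlongrightarrow> 1 - \<theta>) F"
    unfolding X_eq
    by (rule hitting_probability_asymptotics[where U = U and s = s, 
          OF U m pos ret short long s_pos s_large su[unfolded u_def]])
  have Y: "(Y \<longlongrightarrow> 0) F"
    by (rule Lim_transform_eventually[OF fsu]) (simp add: Y_def)
  have phi0: "((\<lambda>i. \<phi> (g i)) \<longlongrightarrow> 0) F"
  proof -
    have "((\<lambda>i. Y i * (real (s i) * u i)) \<longlongrightarrow> 0 * 0) F" by (intro tendsto_mult Y su)
    moreover have "eventually (\<lambda>i. Y i * (real (s i) * u i) = \<phi> (g i)) F"
      using pos s_pos by eventually_elim (simp add: Y_def u_def)
    ultimately have "((\<lambda>i. \<phi> (g i)) \<longlongrightarrow> 0 * 0) F" by (rule Lim_transform_eventually)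
    then show ?thesis by simp
  qed
  have Du: "((\<lambda>i. D i * u i) \<longlongrightarrow> 0) F"
  proof -
    have "((\<lambda>i. (D i / real (s i)) * (real (s i) * u i)) \<longlongrightarrow> 0 * 0) F"
      unfolding D_def by (intro tendsto_mult Ds su)
    moreover have "eventually (\<lambda>i. (D i / real (s i)) * (real (s i) * u i) = D i * u i) F"
      using s_pos by eventually_elim simp
    ultimately have "((\<lambda>i. D i * u i) \<longlongrightarrow> 0 * 0) F" by (rule Lim_transform_eventually)
    then show ?thesis by simp
  qed
  have \<delta>: "((\<lambda>i. D i * u i + \<phi> (g i)) \<longlongrightarrow> 0) F"
    using tendsto_add[OF Du phi0] by simp
  have b: "(b \<longlongrightarrow> 1) F"
  proof -
    have "(b \<longlongrightarrow> 1 / (1 - 2 * 0)) F" unfolding b_def by (intro tendsto_intros \<delta>) simp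
    then show ?thesis by simp
  qed
  have q_eq: "eventually (\<lambda>i. q i = (X i + Y i) * (real (s i) * u i) * b i) F"
    using pos s_pos by eventually_elim (simp add: q_def X_def Y_def u_def field_simps)
  have q: "(q \<longlongrightarrow> 0) F"
  proof -
    have "((\<lambda>i. (X i + Y i) * (real (s i) * u i) * b i) \<longlongrightarrow> (1 - \<theta> + 0) * 0 * 1) F"
      by (intro tendsto_intros X Y su b)
    moreover have "eventually (\<lambda>i. (X i + Y i) * (real (s i) * u i) * b i = q i) F"
      using q_eq by eventually_elim simp
    ultimately have "(q \<longlongrightarrow> (1 - \<theta> + 0) * 0 * 1) F" by (rule Lim_transform_eventually)
    then show ?thesis by simp
  qed
  have ev_\<delta>: "eventually (\<lambda>i. D i * u i + \<phi> (g i) < 1 / 4) F"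
    by (rule order_tendstoD(2)[OF \<delta>]) simp
  have ev_q: "eventually (\<lambda>i. q i < 1) F" by (rule order_tendstoD(2)[OF q]) simp
  show thesis
  proof (rule that[of lo hi])
    show "eventually (\<lambda>i. ereal (lo i) \<le> liminf (escape_quotient M T (U i))) F"
      using s_pos
    proof eventually_elim
      case (elim i)
      show ?case unfolding lo_def
        by (rule liminf_escape_quotient_ge[OF U _ prob_survivors_gap_le[OF obs]]) (use elim in simp)
    qed
    show "eventually (\<lambda>i. limsup (escape_quotient M T (U i)) \<le> ereal (hi i)) F"
      using s_pos ev_\<delta> ev_q
    proof eventually_elim
      case (elim i)
      let ?a = "\<lambda>t. prob (survivors T (U i) t)" and ?\<delta> = "D i * u i + \<phi> (g i)"
      have b_pos: "b i > 0" using elim(2) by (simp add: b_def)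
      have q_nonneg: "q i \<ge> 0"
        using b_pos phi_nonneg[of "g i"] by (simp add: q_def)
      \<comment> \<open>\<open>b i\<close> bounds the ratio between the survival probabilities at \<open>t - (N i + g i)\<close> and at \<open>t\<close>\<close>
      have "(1 - q i) * ?a t \<le> ?a (t + s i)" for t
      proof -
        have "?a (t - (N i + g i)) * (1 - 2 * ?\<delta>) \<le> ?a t"
          using prob_survivors_delay[OF obs[of i] N[of i], where g = "g i"] elim(2)
          by (simp add: D_def u_def)
        then have delay: "?a (t - (N i + g i)) \<le> b i * ?a t"
          using elim(2) by (simp add: b_def field_simps)
        have "?a t - ?a (t + s i) \<le> (1 - ?a (s i) + \<phi> (g i)) * ?a (t - (N i + g i))"
          by (rule prob_survivors_diff_le[OF obs])
        also have "\<dots> \<le> (1 - ?a (s i) + \<phi> (g i)) * (b i * ?a t)"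
          using phi_nonneg[of "g i"] by (intro mult_left_mono delay) simp
        also have "\<dots> = q i * ?a t" by (simp add: q_def)
        finally show ?thesis by (simp add: algebra_simps)
      qed
      then have "limsup (escape_quotient M T (U i)) \<le> ereal ((1 - (1 - q i)) / ((1 - q i) * real (s i)))"
        by (intro limsup_escape_quotient_le U) (use elim q_nonneg in auto)
      then show ?case by (simp add: hi_def)
    qed
    have "((\<lambda>i. (X i - Y i) / (1 + D i / real (s i))) \<longlongrightarrow> (1 - \<theta> - 0) / (1 + 0)) F"
      using Ds by (intro tendsto_intros X Y) (simp_all add: D_def)
    moreover have "eventually (\<lambda>i. (X i - Y i) / (1 + D i / real (s i)) = lo i / prob (U i)) F"
      using s_pos pos
    proof eventually_elim
      case (elim i)
      have "1 + D i / real (s i) = real (s i + N i + g i) / real (s i)"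
        using elim(1) by (simp add: D_def field_simps)
      moreover have "X i - Y i = (1 - (prob (survivors T (U i) (s i)) + \<phi> (g i))) / (real (s i) * u i)"
        by (simp add: X_def Y_def diff_divide_distrib add_divide_distrib)
      ultimately show ?case using elim by (simp add: lo_def u_def)
    qed
    ultimately have "((\<lambda>i. lo i / prob (U i)) \<longlongrightarrow> (1 - \<theta> - 0) / (1 + 0)) F"
      by (rule Lim_transform_eventually)
    then show "((\<lambda>i. lo i / prob (U i)) \<longlongrightarrow> 1 - \<theta>) F" by simp
    have "((\<lambda>i. (X i + Y i) * b i / (1 - q i)) \<longlongrightarrow> (1 - \<theta> + 0) * 1 / (1 - 0)) F"
      by (intro tendsto_intros X Y b q) simp
    moreover have "eventually (\<lambda>i. (X i + Y i) * b i / (1 - q i) = hi i / prob (U i)) F"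
      using s_pos pos ev_q q_eq
    proof eventually_elim
      case (elim i)
      then have "hi i / prob (U i) = ((X i + Y i) * b i) * (real (s i) * u i) / ((1 - q i) * real (s i) * u i)"
        by (simp add: hi_def u_def mult_ac)
      then show ?case using elim by (simp add: u_def)
    qed
    ultimately have "((\<lambda>i. hi i / prob (U i)) \<longlongrightarrow> (1 - \<theta> + 0) * 1 / (1 - 0)) F"
      by (rule Lim_transform_eventually)
    then show "((\<lambda>i. hi i / prob (U i)) \<longlongrightarrow> 1 - \<theta>) F" by simp
  qed
qed

end

section \<open>Cylinder approximations of balls\<close>

text \<open>A larger set is avoided with smaller probability; the value \<open>\<infinity>\<close> at probability \<open>0\<close> is what keeps
  the quotient monotone there.\<close>

lemma (in mixing_system) escape_quotient_mono:
  assumes U: "U \<in> sets M" "V \<in> sets M" and sub: "U \<subseteq> V"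
  shows "escape_quotient M T U t \<le> escape_quotient M T V t"
proof -
  let ?a = "\<lambda>U. prob (survivors T U t)"
  have le: "?a V \<le> ?a U" using survivors_mono_set[OF sub] U by (intro finite_measure_mono) auto
  have "ln (?a V) \<le> ln (?a U)" "ln (?a U) \<le> 0" if "?a V \<noteq> 0"
  proof -
    have "?a V > 0" using that by (simp add: zero_less_measure_iff)
    then show "ln (?a V) \<le> ln (?a U)" "ln (?a U) \<le> 0" using le by auto
  qed
  then have "?a V \<noteq> 0 \<Longrightarrow> \<bar>ln (?a U)\<bar> / real t \<le> \<bar>ln (?a V)\<bar> / real t"
    by (intro divide_right_mono) auto
  moreover have "?a V \<noteq> 0 \<Longrightarrow> ?a U \<noteq> 0" using le by (auto simp: antisym measure_nonneg)
  ultimately show ?thesis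
    unfolding escape_quotient_def prob_entry_time_gt[OF U(1)] prob_entry_time_gt[OF U(2)]
    by (cases "?a V = 0") auto
qed

text \<open>The \<open>n\<close>-cylinder neighbourhood of a set. Besides the outer approximation of a ball, it provides
  the coarsenings of low order that are used to estimate returns.\<close>

definition cylinder_hull :: "('a \<Rightarrow> 'a) \<Rightarrow> 'a set set \<Rightarrow> nat \<Rightarrow> 'a set \<Rightarrow> 'a set" where
  "cylinder_hull T P n S = \<Union>{A \<in> cylinders T P n. A \<inter> S \<noteq> {}}"

lemma observable_cylinder_hull: "observable T P n (cylinder_hull T P n S)"
  unfolding cylinder_hull_def by (rule observable_Union_cylinders) blast

lemma outer_approx_eq_cylinder_hull: "outer_approx T P n x r = cylinder_hull T P n (ball x r)"
  by (simp add: outer_approx_def cylinder_hull_def)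

lemma observable_inner_approx: "observable T P n (inner_approx T P n x r)"
  unfolding inner_approx_def by (rule observable_Union_cylinders) blast

lemma inner_approx_subset_ball: "inner_approx T P n x r \<subseteq> ball x r"
  by (auto simp: inner_approx_def)

lemma (in mixing_system) subset_cylinder_hull: "S \<subseteq> cylinder_hull T P n S"
proof
  fix x assume "x \<in> S"
  obtain A where "A \<in> cylinders T P n" "x \<in> A" by (rule cylinder_through)
  with \<open>x \<in> S\<close> show "x \<in> cylinder_hull T P n S" unfolding cylinder_hull_def by blast
qed

lemma cylinder_hull_subset_ball:
  assumes "\<And>A y z. A \<in> cylinders T P l \<Longrightarrow> y \<in> A \<Longrightarrow> z \<in> A \<Longrightarrow> dist y z \<le> \<delta>" and S: "S \<subseteq> ball x \<rho>"
  shows "cylinder_hull T P l S \<subseteq> ball x (\<rho> + \<delta>)"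
proof
  fix y assume "y \<in> cylinder_hull T P l S"
  then obtain A z where A: "A \<in> cylinders T P l" "y \<in> A" "z \<in> A" "z \<in> S"
    unfolding cylinder_hull_def by blast
  have "dist x y \<le> dist x z + dist z y" by (rule dist_triangle)
  also have "\<dots> < \<rho> + \<delta>"
    using A S assms(1)[OF A(1,3,2)] by (intro add_less_le_mono) auto
  finally show "y \<in> ball x (\<rho> + \<delta>)" by simp
qed

lemma powr_at_right_0: "a > 0 \<Longrightarrow> ((\<lambda>r::real. r powr a) \<longlongrightarrow> 0) (at_right 0)"
  by (rule tendsto_zero_powrI[OF _ tendsto_const])
    (auto intro!: tendsto_eq_intros eventually_at_right_less[THEN eventually_mono] tendsto_ident_at)

text \<open>A substitute for convexity or subadditivity of \<open>t \<mapsto> t\<^sup>d\<close> that is valid for every exponent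
  \<open>d \<ge> 0\<close>.\<close>

lemma powr_add_le:
  fixes a b d :: real
  assumes "a \<ge> 0" "b \<ge> 0" "d \<ge> 0"
  shows "(a + b) powr d \<le> (2 * a) powr d + (2 * b) powr d"
proof -
  have "(a + b) powr d \<le> (2 * max a b) powr d" using assms by (intro powr_mono2) auto
  also have "\<dots> \<le> (2 * a) powr d + (2 * b) powr d" by (cases "a \<le> b") (auto simp: max_def)
  finally show ?thesis .
qed

lemma minimal_period_dvd:
  assumes "minimal_period T x m" "(T ^^ j) x = x"
  shows "m dvd j"
proof -
  have m: "0 < m" "(T ^^ m) x = x" "\<And>i. 0 < i \<Longrightarrow> i < m \<Longrightarrow> (T ^^ i) x \<noteq> x"
    using assms(1) unfolding minimal_period_def by blast+
  have "(T ^^ (j mod m)) x = x" using funpow_mod_eq[OF m(2), of j] assms(2) by simp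
  then have "j mod m = 0" using m(3)[of "j mod m"] m(1) by (metis mod_less_divisor neq0_conv)
  then show ?thesis by (rule mod_0_imp_dvd)
qed

text \<open>The metric structure enters here. Continuity excludes early returns at times that are not periods
  of the centre; quadratic decay of \<open>\<phi>\<close> gives its summability, on which the estimate of late returns rests, and
  determines the time scales.\<close>

locale polynomial_system = mixing_system M T P \<phi>
  for M :: "'a::metric_space measure" and T P \<phi> +
  fixes \<kappa> w d :: real
  assumes continuous: "continuous_on UNIV T"
    and kappa: "\<kappa> > 0"
    and diam: "\<exists>C. \<forall>\<^sub>F n in sequentially. cylinders_diam T P n \<le> ennreal (C * real n powr (- \<kappa>))"
    and w: "w > 1"
    and annulus: "\<And>x. ((\<lambda>r. measure M (ball x (r + r powr w)) / measure M (ball x r)) \<longlongrightarrow> 1) (at_right 0)"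
    and d: "d > 0"
    and ball_measure: "\<exists>C. \<exists>r\<^sub>0>0. \<forall>r. 0 < r \<and> r < r\<^sub>0 \<longrightarrow> (\<forall>x. measure M (ball x r) \<le> C * r powr d)"
    and exponents: "\<kappa> * d / w > 1"
    and phi_bound: "\<exists>C. \<forall>k\<ge>1. \<phi> k \<le> C / (real k)\<^sup>2"
begin

lemma sets_ball [measurable]: "ball x r \<in> sets M"
  using invariant by (simp add: invariant_prob_def)

lemma cylinder_diameter:
  obtains C l0 where "C \<ge> 1" "l0 \<ge> 1"
    "\<And>l A y z. l \<ge> l0 \<Longrightarrow> A \<in> cylinders T P l \<Longrightarrow> y \<in> A \<Longrightarrow> z \<in> A \<Longrightarrow> dist y z \<le> C * real l powr (- \<kappa>)"
proof -
  obtain C0 l0 where C0: "\<And>l. l \<ge> l0 \<Longrightarrow> cylinders_diam T P l \<le> ennreal (C0 * real l powr (- \<kappa>))"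
    using diam unfolding eventually_sequentially by blast
  show thesis
  proof (rule that[of "max C0 1" "max l0 1"])
    fix l A y z
    assume l: "l \<ge> max l0 1" and A: "A \<in> cylinders T P l" and y: "y \<in> A" and z: "z \<in> A"
    have "ennreal (dist y z) \<le> (SUP (x, y) \<in> A \<times> A. ennreal (dist x y))"
      by (rule SUP_upper2[of "(y, z)"]) (use y z in auto)
    also have "\<dots> \<le> cylinders_diam T P l"
      unfolding cylinders_diam_def by (rule SUP_upper[OF A])
    also have "\<dots> \<le> ennreal (C0 * real l powr (- \<kappa>))" using C0 l by simp
    also have "\<dots> \<le> ennreal (max C0 1 * real l powr (- \<kappa>))"
      by (intro ennreal_leI mult_right_mono) auto
    finally show "dist y z \<le> max C0 1 * real l powr (- \<kappa>)" by (simp add: ennreal_le_iff)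
  qed auto
qed

lemma ball_measure_le:
  obtains C r0 where "C \<ge> 0" "r0 > 0" "\<And>r x. 0 < r \<Longrightarrow> r < r0 \<Longrightarrow> prob (ball x r) \<le> C * r powr d"
proof -
  obtain C r0 where C: "r0 > 0" "\<And>r x. 0 < r \<Longrightarrow> r < r0 \<Longrightarrow> prob (ball x r) \<le> C * r powr d"
    using ball_measure by blast
  show thesis
  proof (rule that[of "max C 0" r0])
    fix r x assume r: "0 < r" "r < r0"
    have "prob (ball x r) \<le> C * r powr d" using C r by blast
    also have "\<dots> \<le> max C 0 * r powr d" by (intro mult_right_mono) auto
    finally show "prob (ball x r) \<le> max C 0 * r powr d" .
  qed (use C in auto)
qed

text \<open>Positivity is implicit in the annulus condition, since a quotient by \<open>0\<close> is \<open>0\<close> and cannot tend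
  to \<open>1\<close>.\<close>

lemma prob_ball_pos: "r > 0 \<Longrightarrow> prob (ball x r) > 0"
proof -
  assume r: "r > 0"
  have "eventually (\<lambda>s. prob (ball x (s + s powr w)) / prob (ball x s) > 1 / 2) (at_right 0)"
    by (rule order_tendstoD(1)[OF annulus]) simp
  moreover have "eventually (\<lambda>s::real. s < r) (at_right 0)"
    using eventually_at_right_field r by blast
  ultimately have "eventually (\<lambda>s. prob (ball x (s + s powr w)) / prob (ball x s) > 1 / 2 \<and> s < r) (at_right 0)"
    by (rule eventually_conj)
  then obtain s where s: "prob (ball x (s + s powr w)) / prob (ball x s) > 1 / 2" "s < r"
    using eventually_happens'[OF trivial_limit_at_right_real] by blast
  \<comment> \<open>the quotient would be \<open>0\<close> if its denominator vanished\<close>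
  then have "prob (ball x s) \<noteq> 0" by auto
  moreover have "prob (ball x s) \<le> prob (ball x r)"
    using s by (intro finite_measure_mono) auto
  ultimately show "prob (ball x r) > 0" by (smt (verit) measure_nonneg)
qed

text \<open>The constant in the diameter bound is arbitrary, whereas the annulus condition concerns radius
  \<open>r + r\<^sup>w\<close> only. Iterating \<open>f r = r + r\<^sup>w\<close> a fixed number \<open>k\<close> of times passes \<open>r + k r\<^sup>w\<close>, and the measure
  ratios multiply.\<close>

lemma ball_ratio_outer:
  fixes c :: real
  assumes c: "c \<ge> 0"
  shows "((\<lambda>r. prob (ball x (r + c * r powr w)) / prob (ball x r)) \<longlongrightarrow> 1) (at_right 0)"
proof -
  define f where "f r = r + r powr w" for r :: real
  have f_lim: "filterlim f (at_right 0) (at_right 0)"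
  proof -
    have "((\<lambda>r. r + r powr w) \<longlongrightarrow> 0 + 0) (at_right 0)"
      by (intro tendsto_add powr_at_right_0) (use w in \<open>auto intro: tendsto_ident_at\<close>)
    then have "(f \<longlongrightarrow> 0) (at_right 0)" by (simp add: f_def[abs_def])
    moreover have "eventually (\<lambda>r. f r > 0) (at_right 0)"
      using eventually_at_right_less[of 0] by eventually_elim (simp add: f_def add_pos_nonneg)
    ultimately show ?thesis by (rule tendsto_imp_filterlim_at_right)
  qed
  have fk_lim: "filterlim (f ^^ k) (at_right 0) (at_right 0)" for k
  proof (induction k)
    case (Suc k)
    then show ?case using filterlim_compose[OF f_lim Suc] by (simp add: comp_def)
  qed (simp add: filterlim_ident id_def)
  have fk_ratio: "((\<lambda>r. prob (ball x ((f ^^ k) r)) / prob (ball x r)) \<longlongrightarrow> 1) (at_right 0)" for k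
  proof (induction k)
    case 0
    have "eventually (\<lambda>r. 1 = prob (ball x ((f ^^ 0) r)) / prob (ball x r)) (at_right 0)"
      using eventually_at_right_less[of 0] 
      by eventually_elim (use prob_ball_pos[of _ x] in \<open>simp add: less_imp_neq[symmetric]\<close>)
    then show ?case by (rule Lim_transform_eventually[OF tendsto_const])
  next
    case (Suc k)
    have "((\<lambda>r. prob (ball x (f ((f ^^ k) r))) / prob (ball x ((f ^^ k) r))) \<longlongrightarrow> 1) (at_right 0)"
      using filterlim_compose[OF annulus[of x] fk_lim[of k]] by (simp add: f_def)
    from tendsto_mult[OF this Suc]
    have "((\<lambda>r. prob (ball x (f ((f ^^ k) r))) / prob (ball x ((f ^^ k) r)) *
        (prob (ball x ((f ^^ k) r)) / prob (ball x r))) \<longlongrightarrow> 1) (at_right 0)" by simp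
    moreover have "eventually (\<lambda>r. (f ^^ k) r > 0) (at_right 0)"
      using fk_lim[of k] unfolding filterlim_at by (auto elim: eventually_mono)
    then have "eventually (\<lambda>r. prob (ball x (f ((f ^^ k) r))) / prob (ball x ((f ^^ k) r)) *
        (prob (ball x ((f ^^ k) r)) / prob (ball x r)) = prob (ball x ((f ^^ Suc k) r)) / prob (ball x r)) (at_right 0)"
      by eventually_elim (use prob_ball_pos[of _ x] in \<open>simp add: less_imp_neq[symmetric]\<close>)
    ultimately show ?case by (rule Lim_transform_eventually)
  qed
  have fk_ge: "(f ^^ k) r \<ge> r + real k * r powr w" if "r > 0" for k r
  proof (induction k)
    case (Suc k)
    have "(f ^^ k) r \<ge> r" using Suc by (smt (verit) mult_nonneg_nonneg of_nat_0_le_iff powr_ge_zero)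
    then have "((f ^^ k) r) powr w \<ge> r powr w" using that w by (intro powr_mono2) auto
    moreover have "(f ^^ Suc k) r = (f ^^ k) r + ((f ^^ k) r) powr w" by (simp add: f_def)
    ultimately show ?case using Suc by (simp add: distrib_right)
  qed simp
  define k where "k = nat \<lceil>c\<rceil>"
  have k: "c \<le> real k" unfolding k_def by (rule real_nat_ceiling_ge)
  show ?thesis
  proof (rule tendsto_sandwich[OF _ _ tendsto_const fk_ratio[of k]])
    show "eventually (\<lambda>r. 1 \<le> prob (ball x (r + c * r powr w)) / prob (ball x r)) (at_right 0)"
      using eventually_at_right_less[of 0]
    proof eventually_elim
      case (elim r)
      have "prob (ball x r) \<le> prob (ball x (r + c * r powr w))"
        using c by (intro finite_measure_mono subset_ball) auto
      then show ?case using prob_ball_pos[OF elim, of x] by (simp add: pos_le_divide_eq)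
    qed
    show "eventually (\<lambda>r. prob (ball x (r + c * r powr w)) / prob (ball x r)
        \<le> prob (ball x ((f ^^ k) r)) / prob (ball x r)) (at_right 0)"
      using eventually_at_right_less[of 0]
    proof eventually_elim
      case (elim r)
      have "c * r powr w \<le> real k * r powr w" using k by (intro mult_right_mono) auto
      then have "r + c * r powr w \<le> (f ^^ k) r" using fk_ge[OF elim, of k] by simp
      then show ?case by (intro divide_right_mono finite_measure_mono subset_ball) auto
    qed
  qed
qed

lemma small_annulus_lim: "((\<lambda>r::real. c * r powr w / r) \<longlongrightarrow> 0) (at_right 0)"
proof -
  have "((\<lambda>r. c * r powr (w - 1)) \<longlongrightarrow> c * 0) (at_right 0)"
    by (intro tendsto_intros powr_at_right_0) (use w in simp)
  moreover have "eventually (\<lambda>r. c * r powr (w - 1) = c * r powr w / r) (at_right 0)"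
    using eventually_at_right_less[of 0] by eventually_elim (simp add: powr_diff)
  ultimately have "((\<lambda>r::real. c * r powr w / r) \<longlongrightarrow> c * 0) (at_right 0)"
    by (rule Lim_transform_eventually)
  then show ?thesis by simp
qed

text \<open>Put \<open>\<rho> = r - c r\<^sup>w\<close>. Since \<open>\<rho> / r \<rightarrow> 1\<close>, eventually \<open>\<rho>\<^sup>w \<ge> r\<^sup>w / 2\<close>, so the ball of radius \<open>r\<close> lies in the one of
  radius \<open>\<rho> + 2 c \<rho>\<^sup>w\<close>, which is governed by the outer ratio at \<open>\<rho>\<close>.\<close>

lemma ball_ratio_inner:
  fixes c :: real
  assumes c: "c \<ge> 0"
  shows "((\<lambda>r. prob (ball x (r - c * r powr w)) / prob (ball x r)) \<longlongrightarrow> 1) (at_right 0)"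
proof -
  define \<rho> where "\<rho> r = r - c * r powr w" for r :: real
  have ratio: "((\<lambda>r. \<rho> r / r) \<longlongrightarrow> 1) (at_right 0)"
  proof -
    have "((\<lambda>r. 1 - c * r powr w / r) \<longlongrightarrow> 1 - 0) (at_right 0)"
      by (intro tendsto_intros small_annulus_lim)
    moreover have "eventually (\<lambda>r. 1 - c * r powr w / r = \<rho> r / r) (at_right 0)"
      using eventually_at_right_less[of 0] by eventually_elim (simp add: \<rho>_def diff_divide_distrib)
    ultimately have "((\<lambda>r. \<rho> r / r) \<longlongrightarrow> 1 - 0) (at_right 0)" by (rule Lim_transform_eventually)
    then show ?thesis by simp
  qed
  have pos: "eventually (\<lambda>r. \<rho> r > 0) (at_right 0)"
    using order_tendstoD(1)[OF ratio zero_less_one] eventually_at_right_less[of 0]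
    by eventually_elim (simp add: zero_less_divide_iff)
  have lim: "filterlim \<rho> (at_right 0) (at_right 0)"
  proof -
    have "((\<lambda>r. r - c * r powr w) \<longlongrightarrow> 0 - c * 0) (at_right 0)"
      by (intro tendsto_intros powr_at_right_0) (use w in auto)
    then have "(\<rho> \<longlongrightarrow> 0) (at_right 0)" by (simp add: \<rho>_def[abs_def])
    then show ?thesis using pos by (rule tendsto_imp_filterlim_at_right)
  qed
  have "((\<lambda>r. (\<rho> r / r) powr w) \<longlongrightarrow> 1 powr w) (at_right 0)"
    by (intro tendsto_intros ratio) simp
  then have half: "eventually (\<lambda>r. (\<rho> r / r) powr w > 1 / 2) (at_right 0)"
    by (rule order_tendstoD(1)) simp
  have cover: "eventually (\<lambda>r. r \<le> \<rho> r + (2 * c) * \<rho> r powr w) (at_right 0)"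
    using pos half eventually_at_right_less[of 0]
  proof eventually_elim
    case (elim r)
    have "\<rho> r powr w \<ge> r powr w / 2" using elim by (simp add: powr_divide field_simps)
    then have "2 * c * \<rho> r powr w \<ge> 2 * c * (r powr w / 2)" using c by (intro mult_left_mono) auto
    then show ?case by (simp add: \<rho>_def)
  qed
  have "((\<lambda>r. 1 / (prob (ball x (\<rho> r + (2 * c) * \<rho> r powr w)) / prob (ball x (\<rho> r)))) \<longlongrightarrow> 1 / 1) (at_right 0)"
    by (intro tendsto_divide tendsto_const filterlim_compose[OF ball_ratio_outer lim]) (use c in auto)
  then have lower: "((\<lambda>r. prob (ball x (\<rho> r)) / prob (ball x (\<rho> r + (2 * c) * \<rho> r powr w))) \<longlongrightarrow> 1) (at_right 0)"
    by simp
  have "((\<lambda>r. prob (ball x (\<rho> r)) / prob (ball x r)) \<longlongrightarrow> 1) (at_right 0)"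
  proof (rule tendsto_sandwich[OF _ _ lower tendsto_const])
    show "eventually (\<lambda>r. prob (ball x (\<rho> r)) / prob (ball x (\<rho> r + (2 * c) * \<rho> r powr w))
        \<le> prob (ball x (\<rho> r)) / prob (ball x r)) (at_right 0)"
      using cover eventually_at_right_less[of 0]
    proof eventually_elim
      case (elim r)
      have "prob (ball x r) \<le> prob (ball x (\<rho> r + (2 * c) * \<rho> r powr w))"
        using elim by (intro finite_measure_mono subset_ball) auto
      then show ?case
        using prob_ball_pos[of r x] elim by (intro divide_left_mono mult_pos_pos) auto
    qed
    show "eventually (\<lambda>r. prob (ball x (\<rho> r)) / prob (ball x r) \<le> 1) (at_right 0)"
      using eventually_at_right_less[of 0]
    proof eventually_elim
      case (elim r)
      have "prob (ball x (\<rho> r)) \<le> prob (ball x r)"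
        using c by (intro finite_measure_mono subset_ball) (auto simp: \<rho>_def)
      then show ?case using prob_ball_pos[OF elim, of x] by (simp add: divide_le_eq)
    qed
  qed
  then show ?thesis by (simp add: \<rho>_def)
qed

lemma ball_subset_inner_approx:
  assumes "\<And>A y z. A \<in> cylinders T P l \<Longrightarrow> y \<in> A \<Longrightarrow> z \<in> A \<Longrightarrow> dist y z \<le> \<delta>"
  shows "ball x (r - \<delta>) \<subseteq> inner_approx T P l x r"
proof
  fix y assume y: "y \<in> ball x (r - \<delta>)"
  obtain A where A: "A \<in> cylinders T P l" "y \<in> A" by (rule cylinder_through)
  have "A \<subseteq> ball x r"
  proof
    fix z assume "z \<in> A"
    have "dist x z \<le> dist x y + dist y z" by (rule dist_triangle)
    also have "\<dots> < (r - \<delta>) + \<delta>"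
      using y assms(1)[OF A \<open>z \<in> A\<close>] by (intro add_less_le_mono) auto
    finally show "z \<in> ball x r" by simp
  qed
  then show "y \<in> inner_approx T P l x r" unfolding inner_approx_def using A by blast
qed

lemma approx_order_pos: "approx_order \<kappa> w r \<ge> 1"
  by (simp add: approx_order_def)

lemma approx_order_ge:
  "real (approx_order \<kappa> w r) \<ge> 2 powr (1 / \<kappa>) * r powr (- w / \<kappa>)"
  unfolding approx_order_def by linarith

lemma approx_order_le:
  "real (approx_order \<kappa> w r) \<le> 2 powr (1 / \<kappa>) * r powr (- w / \<kappa>) + 1"
  unfolding approx_order_def by simp

lemma approx_order_powr_le:
  assumes r: "r > 0"
  shows "real (approx_order \<kappa> w r) powr (- \<kappa>) \<le> r powr w"
proof -
  have "real (approx_order \<kappa> w r) powr (- \<kappa>) \<le> (2 powr (1 / \<kappa>) * r powr (- w / \<kappa>)) powr (- \<kappa>)"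
    using approx_order_ge[of r] r kappa by (intro powr_mono2') auto
  also have "\<dots> = 2 powr (-1) * r powr w"
    using kappa r by (simp add: powr_mult powr_powr)
  also have "\<dots> \<le> 1 * r powr w" by (intro mult_right_mono) (auto simp: powr_minus)
  finally show ?thesis by simp
qed

lemma approx_order_at_top: "filterlim (approx_order \<kappa> w) at_top (at_right 0)"
proof -
  have "eventually (\<lambda>r. Z \<le> approx_order \<kappa> w r) (at_right 0)" for Z
  proof -
    define n where "n = max Z 1"
    have "eventually (\<lambda>r::real. r powr w < real n powr (- \<kappa>)) (at_right 0)"
      by (rule order_tendstoD(2)[OF powr_at_right_0]) (use w in \<open>auto simp: n_def\<close>)
    then show ?thesis using eventually_at_right_less[of 0]
    proof eventually_elim
      case (elim r)
      show ?case
      proof (rule ccontr)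
        assume "\<not> Z \<le> approx_order \<kappa> w r"
        then have "real (approx_order \<kappa> w r) \<le> real n" by (simp add: n_def)
        then have "real n powr (- \<kappa>) \<le> real (approx_order \<kappa> w r) powr (- \<kappa>)"
          using approx_order_pos[of r] kappa by (intro powr_mono2') auto
        then show False using approx_order_powr_le[OF elim(2)] elim(1) by linarith
      qed
    qed
  qed
  then show ?thesis by (simp add: filterlim_at_top)
qed

text \<open>The order grows like \<open>r\<^sup>-\<^sup>w\<^sup>/\<^sup>\<kappa>\<close>, and \<open>d > w / \<kappa>\<close> by the hypothesis on the exponents.\<close>

lemma approx_order_mult_powr:
  "((\<lambda>r. real (approx_order \<kappa> w r) * (c * r powr d)) \<longlongrightarrow> 0) (at_right 0)"
proof -
  have dw: "d - w / \<kappa> > 0" using exponents kappa w by (simp add: field_simps)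
  have "((\<lambda>r. \<bar>c\<bar> * (2 powr (1 / \<kappa>) * r powr (d - w / \<kappa>) + r powr d)) \<longlongrightarrow> \<bar>c\<bar> * (2 powr (1 / \<kappa>) * 0 + 0)) (at_right 0)"
    by (intro tendsto_intros powr_at_right_0 dw d)
  then have lim: "((\<lambda>r. \<bar>c\<bar> * (2 powr (1 / \<kappa>) * r powr (d - w / \<kappa>) + r powr d)) \<longlongrightarrow> 0) (at_right 0)" by simp
  show ?thesis
  proof (rule Lim_null_comparison[OF _ lim])
    show "eventually (\<lambda>r. norm (real (approx_order \<kappa> w r) * (c * r powr d))
        \<le> \<bar>c\<bar> * (2 powr (1 / \<kappa>) * r powr (d - w / \<kappa>) + r powr d)) (at_right 0)"
      using eventually_at_right_less[of 0]
    proof eventually_elim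
      case (elim r)
      have "norm (real (approx_order \<kappa> w r) * (c * r powr d)) = real (approx_order \<kappa> w r) * (\<bar>c\<bar> * r powr d)"
        by (simp add: abs_mult)
      also have "\<dots> \<le> (2 powr (1 / \<kappa>) * r powr (- w / \<kappa>) + 1) * (\<bar>c\<bar> * r powr d)"
        by (intro mult_right_mono approx_order_le) auto
      also have "\<dots> = \<bar>c\<bar> * (2 powr (1 / \<kappa>) * (r powr (- w / \<kappa>) * r powr d) + r powr d)"
        by (simp add: algebra_simps)
      also have "r powr (- w / \<kappa>) * r powr d = r powr (d - w / \<kappa>)"
        using elim by (simp add: powr_add[symmetric])
      finally show ?case .
    qed
  qed
qed

end

section \<open>Returns of a small ball to itself\<close>

context polynomial_system
begin

lemma approx_order_cylinder_diameter:
  obtains C where "C \<ge> 1" "eventually (\<lambda>r. \<forall>A y z. A \<in> cylinders T P (approx_order \<kappa> w r) \<longrightarrow> y \<in> A \<longrightarrow> z \<in> A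
      \<longrightarrow> dist y z \<le> C * r powr w) (at_right 0)"
proof -
  obtain C l0 where C: "C \<ge> 1" "l0 \<ge> 1"
    "\<And>l A y z. l \<ge> l0 \<Longrightarrow> A \<in> cylinders T P l \<Longrightarrow> y \<in> A \<Longrightarrow> z \<in> A \<Longrightarrow> dist y z \<le> C * real l powr (- \<kappa>)"
    by (rule cylinder_diameter) blast
  have "eventually (\<lambda>r. approx_order \<kappa> w r \<ge> l0) (at_right 0)"
    using approx_order_at_top by (simp add: filterlim_at_top)
  then have "eventually (\<lambda>r. \<forall>A y z. A \<in> cylinders T P (approx_order \<kappa> w r) \<longrightarrow> y \<in> A \<longrightarrow> z \<in> A
      \<longrightarrow> dist y z \<le> C * r powr w) (at_right 0)"
    using eventually_at_right_less[of 0]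
  proof eventually_elim
    case (elim r)
    have "C * real (approx_order \<kappa> w r) powr (- \<kappa>) \<le> C * r powr w"
      using approx_order_powr_le[OF elim(2)] C(1) by (intro mult_left_mono) auto
    then show ?case using C(3)[OF elim(1)] by (meson order_trans)
  qed
  with C(1) show thesis by (rule that)
qed

text \<open>For \<open>j < 2 * N\<close> the return time does not leave room for a long gap after the \<open>N\<close> symbols that determine
  \<open>U\<close>. Enlarging the first copy of \<open>U\<close> to its hull of order \<open>j div 2\<close> creates a gap of length at least
  \<open>j div 2\<close>, and the hull still lies in a ball of radius \<open>2 r + \<delta>\<close>. For \<open>j \<ge> 2 * N\<close> mixing applies
  to \<open>U\<close> itself.\<close>

lemma return_prob_le:
  assumes U: "observable T P N U" and sub: "U \<subseteq> ball x (2 * r)" and r: "r > 0"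
    and cyl: "\<And>A y z. A \<in> cylinders T P (j div 2) \<Longrightarrow> y \<in> A \<Longrightarrow> z \<in> A \<Longrightarrow> dist y z \<le> \<delta>"
    and ball: "\<And>r. 0 < r \<Longrightarrow> r < r0 \<Longrightarrow> prob (ball x r) \<le> C * r powr d" and C: "C \<ge> 0"
    and \<delta>: "\<delta> \<ge> 0" "2 * r + \<delta> < r0"
  shows "prob (U \<inter> (T ^^ j) -` U) \<le>
    (\<phi> (j div 2) + C * (2 * \<delta>) powr d + prob U + (if j < 2 * N then C * (4 * r) powr d else 0)) * prob U"
proof (cases "j < 2 * N")
  case True
  let ?V = "cylinder_hull T P (j div 2) U"
  note [measurable] = sets_observable[OF U] sets_observable[OF observable_cylinder_hull]
  have "prob (U \<inter> (T ^^ j) -` U) \<le> prob (?V \<inter> (T ^^ j) -` U)"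
    using subset_cylinder_hull by (intro finite_measure_mono) auto
  also have "\<dots> \<le> (prob ?V + \<phi> (j - j div 2)) * prob U"
    by (rule mixing_observable_le[OF observable_cylinder_hull U]) simp
  also have "\<dots> \<le> (C * (2 * \<delta>) powr d + C * (4 * r) powr d + \<phi> (j div 2)) * prob U"
  proof (intro mult_right_mono add_mono phi_antimono)
    have "prob ?V \<le> prob (ball x (2 * r + \<delta>))"
      using cylinder_hull_subset_ball[OF cyl sub] by (intro finite_measure_mono) auto
    also have "\<dots> \<le> C * (2 * r + \<delta>) powr d" using ball[of "2 * r + \<delta>"] r \<delta> by auto
    also have "\<dots> \<le> C * ((2 * (2 * r)) powr d + (2 * \<delta>) powr d)"
      using r \<delta> C d by (intro mult_left_mono powr_add_le) auto
    finally show "prob ?V \<le> C * (2 * \<delta>) powr d + C * (4 * r) powr d" by (simp add: algebra_simps)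
  qed auto
  also have "\<dots> \<le> (\<phi> (j div 2) + C * (2 * \<delta>) powr d + prob U + C * (4 * r) powr d) * prob U"
    by (intro mult_right_mono) auto
  finally show ?thesis using True by simp
next
  case False
  have "prob (U \<inter> (T ^^ j) -` U) \<le> (prob U + \<phi> (j - N)) * prob U"
    by (rule mixing_observable_le[OF U U]) (use False in simp)
  also have "\<dots> \<le> (prob U + \<phi> (j div 2)) * prob U"
    using False by (intro mult_right_mono add_left_mono phi_antimono) auto
  also have "\<dots> \<le> (\<phi> (j div 2) + C * (2 * \<delta>) powr d + prob U) * prob U"
    using C by (intro mult_right_mono) auto
  finally show ?thesis using False by simp
qed

text \<open>Both terms are dominated by powers of \<open>j\<close> with exponents \<open>-2\<close> and \<open>-\<kappa> d < -1\<close>, because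
  \<open>j div 2 \<ge> j / 3\<close> for \<open>j \<ge> 2\<close>.\<close>

lemma summable_half_index:
  assumes c: "c \<ge> 0"
  shows "summable (\<lambda>j. \<phi> (j div 2) + c * (real (j div 2) powr (- \<kappa>)) powr d)"
proof -
  obtain C where C: "\<And>k. k \<ge> 1 \<Longrightarrow> \<phi> k \<le> C / (real k)\<^sup>2" using phi_bound by blast
  have C0: "C \<ge> 0" using order_trans[OF phi_nonneg C[of 1]] by simp
  have kd: "\<kappa> * d > 1"
  proof -
    have "\<kappa> * d > w" using exponents w by (simp add: field_simps)
    then show ?thesis using w by simp
  qed
  have "summable (\<lambda>j. 9 * C * inverse (real j ^ 2) + c * 3 powr (\<kappa> * d) * real j powr (- (\<kappa> * d)))"
    using kd by (intro summable_add summable_mult inverse_power_summable) (auto simp: summable_real_powr_iff)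
  then show ?thesis
  proof (rule summable_comparison_test'[where N = 2])
    fix j :: nat assume j: "j \<ge> 2"
    have "j \<le> 3 * (j div 2)" "j div 2 \<ge> 1" using j by linarith+
    then have half: "real j / 3 \<le> real (j div 2)" "j div 2 \<ge> 1" by linarith+
    have "\<phi> (j div 2) \<le> C / (real (j div 2))\<^sup>2" using C half by simp
    also have "\<dots> \<le> C / (real j / 3)\<^sup>2"
      using half j C0 by (intro divide_left_mono power_mono mult_pos_pos) auto
    also have "\<dots> = 9 * C * inverse (real j ^ 2)" by (simp add: field_simps power2_eq_square)
    finally have 1: "\<phi> (j div 2) \<le> 9 * C * inverse (real j ^ 2)" .
    have "(real (j div 2) powr (- \<kappa>)) powr d = real (j div 2) powr (- (\<kappa> * d))" by (simp add: powr_powr)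
    also have "\<dots> \<le> (real j / 3) powr (- (\<kappa> * d))" using half j kd by (intro powr_mono2') auto
    also have "\<dots> = 3 powr (\<kappa> * d) * real j powr (- (\<kappa> * d))"
      by (simp add: powr_divide powr_minus field_simps)
    finally have "c * (real (j div 2) powr (- \<kappa>)) powr d \<le> c * (3 powr (\<kappa> * d) * real j powr (- (\<kappa> * d)))"
      using c by (intro mult_left_mono)
    then show "norm (\<phi> (j div 2) + c * (real (j div 2) powr (- \<kappa>)) powr d)
        \<le> 9 * C * inverse (real j ^ 2) + c * 3 powr (\<kappa> * d) * real j powr (- (\<kappa> * d))"
      using 1 phi_nonneg[of "j div 2"] c by (simp add: mult.assoc)
  qed
qed

text \<open>Summing the bound for single return times: the part depending on \<open>j\<close> alone is the tail of a
  convergent series, the part \<open>\<mu>(U)\<close> contributes \<open>s \<mu>(U)\<close>, and the part \<open>C (4 r)\<^sup>d\<close> occurs for at most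
  \<open>2 N\<close> values of \<open>j\<close>, which is negligible as \<open>N r\<^sup>d \<rightarrow> 0\<close>.\<close>

lemma long_returns:
  fixes U :: "real \<Rightarrow> 'a set"
  assumes obs: "\<And>r. observable T P (approx_order \<kappa> w r) (U r)"
    and sub: "eventually (\<lambda>r. U r \<subseteq> ball x (2 * r)) (at_right 0)" and \<epsilon>: "\<epsilon> > 0"
  shows "\<exists>K. eventually (\<lambda>r. \<forall>s. (\<Sum>j\<in>{K..<s}. prob (U r \<inter> (T ^^ j) -` U r))
    \<le> (\<epsilon> + real s * prob (U r)) * prob (U r)) (at_right 0)"
proof -
  obtain Cd l0 where Cd: "Cd \<ge> 1" "l0 \<ge> 1" 
    "\<And>l A y z. l \<ge> l0 \<Longrightarrow> A \<in> cylinders T P l \<Longrightarrow> y \<in> A \<Longrightarrow> z \<in> A \<Longrightarrow> dist y z \<le> Cd * real l powr (- \<kappa>)"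
    by (rule cylinder_diameter) blast
  obtain Cb r0 where Cb: "Cb \<ge> 0" "r0 > 0" "\<And>r x. 0 < r \<Longrightarrow> r < r0 \<Longrightarrow> prob (ball x r) \<le> Cb * r powr d"
    by (rule ball_measure_le) blast
  have "((\<lambda>l. Cd * real l powr (- \<kappa>)) \<longlongrightarrow> Cd * 0) sequentially"
    using kappa by (intro tendsto_intros tendsto_neg_powr filterlim_real_sequentially) auto
  then have "eventually (\<lambda>l. Cd * real l powr (- \<kappa>) < r0 / 2) sequentially"
    by (rule order_tendstoD(2)) (use Cb in simp)
  then obtain l1 where l1: "\<And>l. l \<ge> l1 \<Longrightarrow> Cd * real l powr (- \<kappa>) < r0 / 2"
    unfolding eventually_sequentially by blast
  define c where "c = Cb * (2 * Cd) powr d"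
  define \<psi> where "\<psi> j = \<phi> (j div 2) + c * (real (j div 2) powr (- \<kappa>)) powr d" for j
  have c0: "c \<ge> 0" using Cb by (simp add: c_def)
  have "summable \<psi>" unfolding \<psi>_def[abs_def] by (rule summable_half_index[OF c0])
  then obtain K0 where K0: "\<And>m n. m \<ge> K0 \<Longrightarrow> norm (sum \<psi> {m..<n}) < \<epsilon> / 2"
    unfolding summable_Cauchy using \<epsilon> by (metis half_gt_zero)
  \<comment> \<open>beyond \<open>K\<close>, cylinders of order \<open>j div 2\<close> obey the diameter bound and are shorter than \<open>r0 / 2\<close>\<close>
  define K where "K = max K0 (2 * max l0 l1)"
  have "eventually (\<lambda>r::real. r < r0 / 4) (at_right 0)"
    using Cb(2) eventually_at_right_field by (metis divide_pos_pos zero_less_numeral)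
  moreover have "eventually (\<lambda>r. real (approx_order \<kappa> w r) * ((2 * Cb * 4 powr d) * r powr d) < \<epsilon> / 2) (at_right 0)"
    by (rule order_tendstoD(2)[OF approx_order_mult_powr]) (use \<epsilon> in simp)
  ultimately have "eventually (\<lambda>r. \<forall>s. (\<Sum>j\<in>{K..<s}. prob (U r \<inter> (T ^^ j) -` U r))
    \<le> (\<epsilon> + real s * prob (U r)) * prob (U r)) (at_right 0)"
    using sub eventually_at_right_less[of 0]
  proof eventually_elim
    case (elim r)
    let ?N = "approx_order \<kappa> w r" and ?u = "prob (U r)"
    let ?B = "Cb * (4 * r) powr d"
    show ?case
    proof
      fix s
      have "prob (U r \<inter> (T ^^ j) -` U r) \<le> (\<psi> j + (?u + (if j < 2 * ?N then ?B else 0))) * ?u"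
        if "j \<in> {K..<s}" for j
      proof -
        have j: "j div 2 \<ge> l0" "j div 2 \<ge> l1" using that by (auto simp: K_def)
        let ?\<delta> = "Cd * real (j div 2) powr (- \<kappa>)"
        have "prob (U r \<inter> (T ^^ j) -` U r) \<le>
            (\<phi> (j div 2) + Cb * (2 * ?\<delta>) powr d + ?u + (if j < 2 * ?N then ?B else 0)) * ?u"
        proof (rule return_prob_le[OF obs elim(3,4) _ Cb(3) Cb(1)])
          show "2 * r + ?\<delta> < r0" using elim(1) l1[OF j(2)] by simp
          show "dist y z \<le> ?\<delta>" if "A \<in> cylinders T P (j div 2)" "y \<in> A" "z \<in> A" for A y z
            using Cd(3)[OF j(1)] that by blast
        qed (use Cd in auto)
        also have "Cb * (2 * ?\<delta>) powr d = c * (real (j div 2) powr (- \<kappa>)) powr d"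
          using Cd by (simp add: c_def powr_mult)
        finally show ?thesis by (simp add: \<psi>_def add.assoc)
      qed
      then have "(\<Sum>j\<in>{K..<s}. prob (U r \<inter> (T ^^ j) -` U r))
          \<le> (\<Sum>j\<in>{K..<s}. (\<psi> j + (?u + (if j < 2 * ?N then ?B else 0))) * ?u)" by (rule sum_mono)
      also have "\<dots> = (sum \<psi> {K..<s} + (real (card {K..<s}) * ?u + (\<Sum>j\<in>{K..<s}. if j < 2 * ?N then ?B else 0))) * ?u"
        by (simp add: sum_distrib_right[symmetric] sum.distrib)
      also have "\<dots> \<le> (\<epsilon> / 2 + (real s * ?u + \<epsilon> / 2)) * ?u"
      proof (intro mult_right_mono add_mono)
        show "sum \<psi> {K..<s} \<le> \<epsilon> / 2" using K0[of K s] by (simp add: K_def)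
        have "(\<Sum>j\<in>{K..<s}. if j < 2 * ?N then ?B else 0) = (\<Sum>j\<in>{K..<s} \<inter> {j. j < 2 * ?N}. ?B)"
          by (simp add: sum.If_cases)
        also have "\<dots> = real (card ({K..<s} \<inter> {j. j < 2 * ?N})) * ?B" by simp
        also have "\<dots> \<le> real (2 * ?N) * ?B"
          using card_mono[of "{..<2 * ?N}" "{K..<s} \<inter> {j. j < 2 * ?N}"] Cb(1)
          by (intro mult_right_mono) (auto simp: lessThan_def)
        also have "\<dots> = real ?N * ((2 * Cb * 4 powr d) * r powr d)"
          using elim(4) by (simp add: powr_mult)
        finally show "(\<Sum>j\<in>{K..<s}. if j < 2 * ?N then ?B else 0) \<le> \<epsilon> / 2" using elim(2) by simp
      qed auto
      also have "\<dots> = (\<epsilon> + real s * ?u) * ?u" by (simp add: algebra_simps)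
      finally show "(\<Sum>j\<in>{K..<s}. prob (U r \<inter> (T ^^ j) -` U r)) \<le> (\<epsilon> + real s * ?u) * ?u" .
    qed
  qed
  then show ?thesis by blast
qed

lemma no_return_to_small_ball:
  assumes "(T ^^ j) x \<noteq> x"
  shows "eventually (\<lambda>r. ball x (2 * r) \<inter> (T ^^ j) -` ball x (2 * r) = {}) (at_right 0)"
proof -
  have cont: "continuous_on UNIV (T ^^ j)"
  proof (induction j)
    case (Suc j)
    have "continuous_on UNIV (\<lambda>x. T ((T ^^ j) x))"
      using continuous_on_compose2[OF continuous Suc] by simp
    then show ?case by (simp add: comp_def)
  qed (simp add: id_def)
  define e where "e = dist ((T ^^ j) x) x / 2"
  have e: "e > 0" using assms by (simp add: e_def)
  then obtain \<delta> where \<delta>: "\<delta> > 0" "\<And>y. dist y x < \<delta> \<Longrightarrow> dist ((T ^^ j) y) ((T ^^ j) x) < e"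
    using cont unfolding continuous_on_iff by (metis UNIV_I)
  have "eventually (\<lambda>r::real. r < min \<delta> e / 2) (at_right 0)"
    using \<delta> e by (intro eventually_at_rightI[of 0 "min \<delta> e / 2"]) auto
  then show ?thesis
  proof eventually_elim
    case (elim r)
    have False if y: "y \<in> ball x (2 * r)" "(T ^^ j) y \<in> ball x (2 * r)" for y
    proof -
      have "dist ((T ^^ j) y) ((T ^^ j) x) < e"
        using y(1) elim by (intro \<delta>(2)) (auto simp: dist_commute)
      moreover have "dist ((T ^^ j) y) x < e" using y(2) elim by (auto simp: dist_commute)
      ultimately have "dist ((T ^^ j) x) x < e + e"
        using dist_triangle_less_add[of "(T ^^ j) x" "(T ^^ j) y" e x e] by (simp add: dist_commute)
      then show False by (simp add: e_def)
    qed
    then show ?case by blast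
  qed
qed

lemma short_returns_nonrecurrent:
  fixes U :: "real \<Rightarrow> 'a set"
  assumes sub: "eventually (\<lambda>r. U r \<subseteq> ball x (2 * r)) (at_right 0)" and j: "(T ^^ j) x \<noteq> x"
  shows "((\<lambda>r. prob (U r \<inter> (T ^^ j) -` U r - V r) / prob (U r)) \<longlongrightarrow> 0) (at_right 0)"
proof (rule Lim_transform_eventually[OF tendsto_const])
  show "eventually (\<lambda>r. 0 = prob (U r \<inter> (T ^^ j) -` U r - V r) / prob (U r)) (at_right 0)"
    using sub no_return_to_small_ball[OF j]
  proof eventually_elim
    case (elim r)
    then have "U r \<inter> (T ^^ j) -` U r - V r = {}" by blast
    then show ?case by (simp only: measure_empty)
  qed
qed

text \<open>A return time \<open>j\<close> that is not a multiple of \<open>m\<close> moves the centre, so continuity excludes it.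
  For a multiple of \<open>m\<close>, apply the overlap property to the pair of times \<open>0, j\<close>; this is permitted for small
  radii because \<open>J(n) n\<close> is at least of order \<open>n\<^sup>\<zeta>\<close>. It says that returning at time \<open>j\<close> and visiting \<open>U\<close> at every multiple
  of \<open>m\<close> up to \<open>j\<close>, in particular at time \<open>m\<close>, have nearly the same measure.\<close>

lemma short_returns_periodic:
  fixes U :: "real \<Rightarrow> 'a set"
  assumes obs: "\<And>r. observable T P (approx_order \<kappa> w r) (U r)"
    and sub: "eventually (\<lambda>r. U r \<subseteq> ball x (2 * r)) (at_right 0)"
    and per: "minimal_period T x m" and \<zeta>: "\<zeta> > 0"
    and overlap: "periodic_overlap_property M T x \<zeta> (approx_order \<kappa> w) U" and j: "j \<ge> 1"
  shows "((\<lambda>r. prob (U r \<inter> (T ^^ j) -` U r - (T ^^ m) -` U r) / prob (U r)) \<longlongrightarrow> 0) (at_right 0)"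
proof (cases "m dvd j")
  case False
  then have "(T ^^ j) x \<noteq> x" using minimal_period_dvd[OF per] by blast
  then show ?thesis by (rule short_returns_nonrecurrent[OF sub])
next
  case True
  have m: "m \<ge> 1" using per by (simp add: minimal_period_def Suc_le_eq)
  obtain J \<epsilon> where J: "\<forall>n\<ge>1. 0 < J n \<and> J n < 1" "\<exists>C. \<forall>n\<ge>1. real n powr (\<zeta> - 1) \<le> C * J n"
    and \<epsilon>: "\<epsilon> \<longlonglongrightarrow> 0"
    and split: "\<forall>r>0. \<forall>k (i :: nat \<Rightarrow> nat).
             i 0 = 0 \<and> (\<forall>j<k. i j < i (Suc j)) \<and> (\<forall>j\<le>k. m dvd i j) \<and>
             real (i k) \<le> J (approx_order \<kappa> w r) * real (approx_order \<kappa> w r) \<longrightarrow>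
             (\<exists>\<theta>. \<bar>\<theta>\<bar> \<le> \<bar>\<epsilon> (approx_order \<kappa> w r)\<bar> \<and>
                measure M (\<Inter>j\<in>{..k}. (T ^^ i j) -` U r) =
                measure M (\<Inter>j\<in>{..i k div m}. (T ^^ (j * m)) -` U r) * (1 + \<theta>))"
    using overlap[unfolded periodic_overlap_property_def, rule_format, OF per] by blast
  obtain C where C: "\<And>n. n \<ge> 1 \<Longrightarrow> real n powr (\<zeta> - 1) \<le> C * J n" using J(2) by blast
  have "((\<lambda>n. C * real j * real n powr (- \<zeta>)) \<longlongrightarrow> C * real j * 0) sequentially"
    using \<zeta> by (intro tendsto_intros tendsto_neg_powr filterlim_real_sequentially) auto
  then have "eventually (\<lambda>n. C * real j * real n powr (- \<zeta>) < 1) sequentially"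
    by (rule order_tendstoD(2)) simp
  then have "eventually (\<lambda>n. real j \<le> J n * real n) sequentially"
    using eventually_ge_at_top[of 1]
  proof eventually_elim
    case (elim n)
    have "0 < real n powr (\<zeta> - 1)" using elim by simp
    also have "\<dots> \<le> C * J n" using C elim by simp
    finally have "C * J n > 0" .
    moreover have "J n > 0" using J(1) elim by blast
    ultimately have C0: "C > 0" by (simp add: zero_less_mult_iff)
    have "C * real j \<le> real n powr \<zeta>" using elim by (simp add: powr_minus field_simps)
    also have "\<dots> = real n powr (\<zeta> - 1) * real n" using elim by (simp add: powr_diff)
    also have "\<dots> \<le> C * J n * real n" using C elim by (intro mult_right_mono) auto
    finally show ?case using C0 by (simp add: mult.assoc)
  qed
  then have far: "eventually (\<lambda>r. real j \<le> J (approx_order \<kappa> w r) * real (approx_order \<kappa> w r)) (at_right 0)"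
    by (rule eventually_compose_filterlim[OF _ approx_order_at_top])
  have \<epsilon>': "((\<lambda>r. \<bar>\<epsilon> (approx_order \<kappa> w r)\<bar>) \<longlongrightarrow> 0) (at_right 0)"
    using tendsto_rabs_zero[OF filterlim_compose[OF \<epsilon> approx_order_at_top]] .
  show ?thesis
  proof (rule tendsto_sandwich[OF _ _ tendsto_const \<epsilon>'])
    show "eventually (\<lambda>r. prob (U r \<inter> (T ^^ j) -` U r - (T ^^ m) -` U r) / prob (U r)
        \<le> \<bar>\<epsilon> (approx_order \<kappa> w r)\<bar>) (at_right 0)"
      using far eventually_at_right_less[of 0]
    proof eventually_elim
      case (elim r)
      note [measurable] = sets_observable[OF obs[of r]]
      let ?I = "\<Inter>i\<in>{..j div m}. (T ^^ (i * m)) -` U r"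
      let ?R = "U r \<inter> (T ^^ j) -` U r"
      \<comment> \<open>the overlap property for \<open>k = 1\<close>, \<open>i\<^sub>0 = 0\<close> and \<open>i\<^sub>1 = j\<close>\<close>
      have "(\<Inter>i\<in>{..1::nat}. (T ^^ (i * j)) -` U r) = ?R" by (auto simp: le_Suc_eq)
      then obtain \<theta> where \<theta>: "\<bar>\<theta>\<bar> \<le> \<bar>\<epsilon> (approx_order \<kappa> w r)\<bar>" "prob ?R = prob ?I * (1 + \<theta>)"
        using split[rule_format, where i = "\<lambda>i. i * j" and k = 1, OF elim(2)] elim(1) True j by auto
      have I: "?I \<in> sets M" by (intro sets.finite_INT) auto
      have div: "j div m \<ge> 1" "j div m * m = j" using True m j by (auto simp: Suc_le_eq div_greater_zero_iff dvd_imp_le)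
      have I_sub: "?I \<subseteq> (T ^^ (0 * m)) -` U r" "?I \<subseteq> (T ^^ (1 * m)) -` U r" "?I \<subseteq> (T ^^ (j div m * m)) -` U r"
        using div by (intro INT_lower; simp)+
      have prob_I: "prob ?I \<le> prob (U r)" using I_sub(1) by (intro finite_measure_mono) auto
      have "prob (?R - (T ^^ m) -` U r) \<le> prob (?R - ?I)"
        using I I_sub by (intro finite_measure_mono) auto
      also have "\<dots> = prob ?R - prob ?I"
        using I I_sub div by (intro finite_measure_Diff) auto
      also have "\<dots> = prob ?I * \<theta>" using \<theta>(2) by (simp add: algebra_simps)
      also have "\<dots> \<le> prob ?I * \<bar>\<theta>\<bar>" by (intro mult_left_mono) auto
      also have "\<dots> \<le> prob (U r) * \<bar>\<epsilon> (approx_order \<kappa> w r)\<bar>"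
        using \<theta>(1) prob_I by (intro mult_mono) auto
      finally show ?case
        by (cases "prob (U r) = 0") (auto simp: zero_less_measure_iff pos_divide_le_eq mult.commute)
    qed
  qed simp
qed

end

section \<open>Localised escape rates\<close>

context polynomial_system
begin

text \<open>Transfer from cylinder approximations to balls: all quantities may be normalised by the
  measure of the ball instead of that of \<open>U\<close>, and the return proportion of \<open>U\<close> at time \<open>m\<close> has the same limit
  because \<open>U\<close> and the ball are nested with asymptotically equal measures.\<close>

lemma escape_bounds_near_balls:
  fixes U :: "real \<Rightarrow> 'a set"
  assumes obs: "\<And>r. observable T P (approx_order \<kappa> w r) (U r)" and m: "m \<ge> 1"
    and sub: "eventually (\<lambda>r. U r \<subseteq> ball x (2 * r)) (at_right 0)"
    and nested: "eventually (\<lambda>r. U r \<subseteq> ball x r \<or> ball x r \<subseteq> U r) (at_right 0)"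
    and ratio: "((\<lambda>r. prob (U r) / prob (ball x r)) \<longlongrightarrow> 1) (at_right 0)"
    and ret: "((\<lambda>r. prob (ball x r \<inter> (T ^^ m) -` ball x r) / prob (ball x r)) \<longlongrightarrow> \<theta>) (at_right 0)"
    and short: "\<And>j. j \<ge> 1 \<Longrightarrow>
      ((\<lambda>r. prob (U r \<inter> (T ^^ j) -` U r - (T ^^ m) -` U r) / prob (U r)) \<longlongrightarrow> 0) (at_right 0)"
  obtains lo hi :: "real \<Rightarrow> real"
  where "eventually (\<lambda>r. ereal (lo r) \<le> liminf (escape_quotient M T (U r))) (at_right 0)"
    and "((\<lambda>r. lo r / prob (ball x r)) \<longlongrightarrow> 1 - \<theta>) (at_right 0)"
    and "eventually (\<lambda>r. limsup (escape_quotient M T (U r)) \<le> ereal (hi r)) (at_right 0)"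
    and "((\<lambda>r. hi r / prob (ball x r)) \<longlongrightarrow> 1 - \<theta>) (at_right 0)"
proof -
  let ?u = "\<lambda>r. prob (U r)" and ?b = "\<lambda>r. prob (ball x r)"
  have b_pos: "eventually (\<lambda>r. ?b r > 0) (at_right 0)"
    using eventually_at_right_less[of 0] by eventually_elim (rule prob_ball_pos)
  have "eventually (\<lambda>r. ?u r / ?b r > 0) (at_right 0)" by (rule order_tendstoD(1)[OF ratio]) simp
  then have pos: "eventually (\<lambda>r. ?u r > 0) (at_right 0)"
    using b_pos by eventually_elim (simp add: zero_less_divide_iff)
  have small: "((\<lambda>r. real (approx_order \<kappa> w r) * ?u r) \<longlongrightarrow> 0) (at_right 0)"
  proof -
    obtain C r0 where C: "C \<ge> 0" "r0 > 0" "\<And>r x. 0 < r \<Longrightarrow> r < r0 \<Longrightarrow> prob (ball x r) \<le> C * r powr d"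
      by (rule ball_measure_le) blast
    have "eventually (\<lambda>r::real. r < r0 / 2) (at_right 0)"
      using C(2) by (intro eventually_at_rightI[of 0 "r0 / 2"]) auto
    then have "eventually (\<lambda>r. norm (real (approx_order \<kappa> w r) * ?u r)
        \<le> real (approx_order \<kappa> w r) * ((C * 2 powr d) * r powr d)) (at_right 0)"
      using sub eventually_at_right_less[of 0]
    proof eventually_elim
      case (elim r)
      have "?u r \<le> prob (ball x (2 * r))" using elim by (intro finite_measure_mono) auto
      also have "\<dots> \<le> C * (2 * r) powr d" using elim by (intro C) auto
      also have "\<dots> = (C * 2 powr d) * r powr d" using elim by (simp add: powr_mult)
      finally show ?case by (simp add: mult_left_mono)
    qed
    then show ?thesis by (rule Lim_null_comparison[OF _ approx_order_mult_powr])
  qed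
  have ret': "((\<lambda>r. prob (U r \<inter> (T ^^ m) -` U r) / ?u r) \<longlongrightarrow> \<theta>) (at_right 0)"
  proof -
    let ?R = "\<lambda>S. prob (S \<inter> (T ^^ m) -` S)"
    have "((\<lambda>r. 2 * \<bar>?u r / ?b r - 1\<bar>) \<longlongrightarrow> 2 * \<bar>1 - 1\<bar>) (at_right 0)"
      by (intro tendsto_intros ratio)
    then have lim: "((\<lambda>r. 2 * \<bar>?u r / ?b r - 1\<bar>) \<longlongrightarrow> 0) (at_right 0)" by simp
    have "((\<lambda>r. (?R (U r) - ?R (ball x r)) / ?b r) \<longlongrightarrow> 0) (at_right 0)"
    proof (rule Lim_null_comparison[OF _ lim])
      show "eventually (\<lambda>r. norm ((?R (U r) - ?R (ball x r)) / ?b r) \<le> 2 * \<bar>?u r / ?b r - 1\<bar>) (at_right 0)"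
        using nested b_pos
      proof eventually_elim
        case (elim r)
        have "\<bar>?R (U r) - ?R (ball x r)\<bar> \<le> 2 * \<bar>?u r - ?b r\<bar>"
          using elim(1) return_prob_diff[OF sets_observable[OF obs] sets_ball, of r x r m]
            return_prob_diff[OF sets_ball sets_observable[OF obs], of x r r m] by auto
        then have "\<bar>?R (U r) - ?R (ball x r)\<bar> / ?b r \<le> 2 * \<bar>?u r - ?b r\<bar> / ?b r"
          using elim by (intro divide_right_mono) auto
        moreover have "?u r / ?b r - 1 = (?u r - ?b r) / ?b r"
          using elim(2) by (simp add: diff_divide_distrib)
        ultimately show ?case using elim(2) by (simp add: abs_divide)
      qed
    qed
    from tendsto_divide[OF tendsto_add[OF this ret] ratio]
    have "((\<lambda>r. ((?R (U r) - ?R (ball x r)) / ?b r + ?R (ball x r) / ?b r) / (?u r / ?b r)) \<longlongrightarrow> \<theta>) (at_right 0)"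
      by simp
    moreover have "eventually (\<lambda>r. ((?R (U r) - ?R (ball x r)) / ?b r + ?R (ball x r) / ?b r) / (?u r / ?b r)
        = ?R (U r) / ?u r) (at_right 0)"
      using b_pos by eventually_elim (simp add: diff_divide_distrib)
    ultimately show ?thesis by (rule Lim_transform_eventually)
  qed
  obtain C where C: "\<And>k. k \<ge> 1 \<Longrightarrow> \<phi> k \<le> C / (real k)\<^sup>2" using phi_bound by blast
  have rescale: "((\<lambda>r. l r / ?b r) \<longlongrightarrow> 1 - \<theta>) (at_right 0)"
    if "((\<lambda>r. l r / ?u r) \<longlongrightarrow> 1 - \<theta>) (at_right 0)" for l
  proof -
    have "((\<lambda>r. (l r / ?u r) * (?u r / ?b r)) \<longlongrightarrow> (1 - \<theta>) * 1) (at_right 0)"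
      by (intro tendsto_mult that ratio)
    moreover have "eventually (\<lambda>r. (l r / ?u r) * (?u r / ?b r) = l r / ?b r) (at_right 0)"
      using pos by eventually_elim simp
    ultimately have "((\<lambda>r. l r / ?b r) \<longlongrightarrow> (1 - \<theta>) * 1) (at_right 0)" by (rule Lim_transform_eventually)
    then show ?thesis by simp
  qed
  show thesis
    by (rule escape_rate_asymptotics[where U = U and F = "at_right 0", OF obs approx_order_pos m pos small C ret' short
          long_returns[OF obs sub]]) (auto intro: that rescale)
qed

lemma inner_approx_measure_ratio:
  "((\<lambda>r. prob (inner_approx T P (approx_order \<kappa> w r) x r) / prob (ball x r)) \<longlongrightarrow> 1) (at_right 0)"
proof -
  obtain C where C: "C \<ge> 1" "eventually (\<lambda>r. \<forall>A y z. A \<in> cylinders T P (approx_order \<kappa> w r) \<longrightarrow> y \<in> A \<longrightarrow> z \<in> A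
      \<longrightarrow> dist y z \<le> C * r powr w) (at_right 0)"
    by (rule approx_order_cylinder_diameter)
  note [measurable] = sets_observable[OF observable_inner_approx]
  show ?thesis
  proof (rule tendsto_sandwich[OF _ _ ball_ratio_inner tendsto_const])
    show "eventually (\<lambda>r. prob (ball x (r - C * r powr w)) / prob (ball x r)
        \<le> prob (inner_approx T P (approx_order \<kappa> w r) x r) / prob (ball x r)) (at_right 0)"
      using C(2)
    proof eventually_elim
      case (elim r)
      then show ?case
        by (intro divide_right_mono finite_measure_mono ball_subset_inner_approx) auto
    qed
    show "eventually (\<lambda>r. prob (inner_approx T P (approx_order \<kappa> w r) x r) / prob (ball x r) \<le> 1) (at_right 0)"
    proof (intro always_eventually allI)
      fix r
      have "prob (inner_approx T P (approx_order \<kappa> w r) x r) \<le> prob (ball x r)"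
        by (intro finite_measure_mono inner_approx_subset_ball) auto
      then show "prob (inner_approx T P (approx_order \<kappa> w r) x r) / prob (ball x r) \<le> 1"
        by (simp add: divide_le_eq_1 zero_less_measure_iff)
    qed
  qed (use C in simp)
qed

lemma outer_approx_measure_ratio:
  "((\<lambda>r. prob (outer_approx T P (approx_order \<kappa> w r) x r) / prob (ball x r)) \<longlongrightarrow> 1) (at_right 0)"
  and outer_approx_subset_ball:
  "eventually (\<lambda>r. outer_approx T P (approx_order \<kappa> w r) x r \<subseteq> ball x (2 * r)) (at_right 0)"
proof -
  obtain C where C: "C \<ge> 1" "eventually (\<lambda>r. \<forall>A y z. A \<in> cylinders T P (approx_order \<kappa> w r) \<longrightarrow> y \<in> A \<longrightarrow> z \<in> A
      \<longrightarrow> dist y z \<le> C * r powr w) (at_right 0)"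
    by (rule approx_order_cylinder_diameter)
  note [measurable] = sets_observable[OF observable_cylinder_hull]
  have near: "eventually (\<lambda>r. outer_approx T P (approx_order \<kappa> w r) x r \<subseteq> ball x (r + C * r powr w)) (at_right 0)"
    using C(2)
  proof eventually_elim
    case (elim r)
    then show ?case unfolding outer_approx_eq_cylinder_hull by (intro cylinder_hull_subset_ball) auto
  qed
  have "eventually (\<lambda>r::real. C * r powr w / r < 1) (at_right 0)"
    by (rule order_tendstoD(2)[OF small_annulus_lim]) simp
  with near eventually_at_right_less[of 0]
  show "eventually (\<lambda>r. outer_approx T P (approx_order \<kappa> w r) x r \<subseteq> ball x (2 * r)) (at_right 0)"
  proof eventually_elim
    case (elim r)
    then have "ball x (r + C * r powr w) \<subseteq> ball x (2 * r)" by (intro subset_ball) (simp add: divide_less_eq)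
    with elim(1) show ?case by blast
  qed
  show "((\<lambda>r. prob (outer_approx T P (approx_order \<kappa> w r) x r) / prob (ball x r)) \<longlongrightarrow> 1) (at_right 0)"
  proof (rule tendsto_sandwich[OF _ _ tendsto_const ball_ratio_outer])
    show "eventually (\<lambda>r. 1 \<le> prob (outer_approx T P (approx_order \<kappa> w r) x r) / prob (ball x r)) (at_right 0)"
      using eventually_at_right_less[of 0]
    proof eventually_elim
      case (elim r)
      have "prob (ball x r) \<le> prob (outer_approx T P (approx_order \<kappa> w r) x r)"
        unfolding outer_approx_eq_cylinder_hull by (intro finite_measure_mono subset_cylinder_hull) auto
      then show ?case using prob_ball_pos[OF elim, of x] by (simp add: pos_le_divide_eq)
    qed
    show "eventually (\<lambda>r. prob (outer_approx T P (approx_order \<kappa> w r) x r) / prob (ball x r)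
        \<le> prob (ball x (r + C * r powr w)) / prob (ball x r)) (at_right 0)"
      using near by eventually_elim (intro divide_right_mono finite_measure_mono, auto)
  qed (use C in simp)
qed

text \<open>The lower bound for the inner approximation bounds the lower escape rate of the ball from below, the
  upper bound for the outer one bounds its upper escape rate from above, and both bounds have the same
  limit. Where the escape rate exists it is equal to the upper one.\<close>

proposition has_localised_escape_rate_of_short_returns:
  assumes m: "m \<ge> 1"
    and ret: "((\<lambda>r. prob (ball x r \<inter> (T ^^ m) -` ball x r) / prob (ball x r)) \<longlongrightarrow> \<theta>) (at_right 0)"
    and short: "\<And>j U. j \<ge> 1 \<Longrightarrow> eventually (\<lambda>r. U r \<subseteq> ball x (2 * r)) (at_right 0) \<Longrightarrow>
      U = (\<lambda>r. inner_approx T P (approx_order \<kappa> w r) x r) \<or> U = (\<lambda>r. outer_approx T P (approx_order \<kappa> w r) x r) \<Longrightarrow>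
      ((\<lambda>r. prob (U r \<inter> (T ^^ j) -` U r - (T ^^ m) -` U r) / prob (U r)) \<longlongrightarrow> 0) (at_right 0)"
  shows "has_localised_escape_rate M T x (1 - \<theta>)"
proof -
  let ?I = "\<lambda>r. inner_approx T P (approx_order \<kappa> w r) x r"
  let ?O = "\<lambda>r. outer_approx T P (approx_order \<kappa> w r) x r"
  let ?E = "\<lambda>r. escape_quotient M T (ball x r)" and ?b = "\<lambda>r. prob (ball x r)"
  have obs_O: "observable T P (approx_order \<kappa> w r) (?O r)" for r
    unfolding outer_approx_eq_cylinder_hull by (rule observable_cylinder_hull)
  have sub_O: "ball x r \<subseteq> ?O r" for r
    unfolding outer_approx_eq_cylinder_hull by (rule subset_cylinder_hull)
  have sub_I: "eventually (\<lambda>r. ?I r \<subseteq> ball x (2 * r)) (at_right 0)"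
    using eventually_at_right_less[of 0]
  proof eventually_elim
    case (elim r)
    then have "ball x r \<subseteq> ball x (2 * r)" by (intro subset_ball) simp
    then show ?case using inner_approx_subset_ball by (rule order_trans[rotated])
  qed
  obtain lo where lo: "eventually (\<lambda>r. ereal (lo r) \<le> liminf (escape_quotient M T (?I r))) (at_right 0)"
      "((\<lambda>r. lo r / ?b r) \<longlongrightarrow> 1 - \<theta>) (at_right 0)"
    by (rule escape_bounds_near_balls[where U = ?I, OF observable_inner_approx m sub_I _ inner_approx_measure_ratio ret
          short[OF _ sub_I]]) (auto simp: inner_approx_subset_ball)
  obtain hi where hi: "eventually (\<lambda>r. limsup (escape_quotient M T (?O r)) \<le> ereal (hi r)) (at_right 0)"
      "((\<lambda>r. hi r / ?b r) \<longlongrightarrow> 1 - \<theta>) (at_right 0)"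
    by (rule escape_bounds_near_balls[where U = ?O, OF obs_O m outer_approx_subset_ball _ outer_approx_measure_ratio ret
          short[OF _ outer_approx_subset_ball]]) (auto simp: sub_O)
  have bounds: "eventually (\<lambda>r. ereal (lo r / ?b r) \<le> liminf (?E r) / ereal (?b r)
      \<and> liminf (?E r) / ereal (?b r) \<le> limsup (?E r) / ereal (?b r)
      \<and> limsup (?E r) / ereal (?b r) \<le> ereal (hi r / ?b r)) (at_right 0)"
    using lo(1) hi(1) eventually_at_right_less[of 0]
  proof eventually_elim
    case (elim r)
    have b: "?b r > 0" using elim(3) by (rule prob_ball_pos)
    have "liminf (escape_quotient M T (?I r)) \<le> liminf (?E r)"
      by (intro Liminf_mono always_eventually allI escape_quotient_mono sets_observable[OF observable_inner_approx]
            sets_ball inner_approx_subset_ball)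
    with elim(1) have 1: "ereal (lo r) \<le> liminf (?E r)" by (rule order_trans)
    have "limsup (?E r) \<le> limsup (escape_quotient M T (?O r))"
      by (intro Limsup_mono always_eventually allI escape_quotient_mono sets_observable[OF obs_O] sets_ball sub_O)
    from this elim(2) have 2: "limsup (?E r) \<le> ereal (hi r)" by (rule order_trans)
    have 3: "liminf (?E r) \<le> limsup (?E r)" by (intro Liminf_le_Limsup) simp
    have "ereal (l / ?b r) = ereal l / ereal (?b r)" for l using b by simp
    then show ?case using 1 2 3 b by (simp only:) (intro conjI ereal_divide_right_mono; simp)
  qed
  have lo': "((\<lambda>r. ereal (lo r / ?b r)) \<longlongrightarrow> ereal (1 - \<theta>)) (at_right 0)"
    and hi': "((\<lambda>r. ereal (hi r / ?b r)) \<longlongrightarrow> ereal (1 - \<theta>)) (at_right 0)"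
    using lo(2) hi(2) by (auto intro: tendsto_ereal)
  have inf: "((\<lambda>r. liminf (?E r) / ereal (?b r)) \<longlongrightarrow> ereal (1 - \<theta>)) (at_right 0)"
    by (rule tendsto_sandwich[OF _ _ lo' hi'])
      (use bounds in \<open>eventually_elim, blast intro: order_trans\<close>)+
  have sup: "((\<lambda>r. limsup (?E r) / ereal (?b r)) \<longlongrightarrow> ereal (1 - \<theta>)) (at_right 0)"
    by (rule tendsto_sandwich[OF _ _ lo' hi'])
      (use bounds in \<open>eventually_elim, blast intro: order_trans\<close>)+
  let ?S = "{r. 0 < r \<and> escape_rate_exists M T (ball x r)}"
  have "((\<lambda>r. limsup (?E r) / ereal (?b r)) \<longlongrightarrow> ereal (1 - \<theta>)) (at 0 within ?S)"
    using sup by (rule tendsto_within_subset) auto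
  moreover have "eventually (\<lambda>r. limsup (?E r) / ereal (?b r) = escape_rate M T (ball x r) / ereal (?b r)) (at 0 within ?S)"
    unfolding eventually_at_filter
  proof (intro always_eventually allI impI)
    fix r assume "r \<in> ?S"
    then have "convergent (?E r)" by (simp add: escape_rate_exists_def convergent_def)
    then show "limsup (?E r) / ereal (?b r) = escape_rate M T (ball x r) / ereal (?b r)"
      unfolding escape_rate_def by (simp add: convergent_limsup_cl)
  qed
  ultimately have "((\<lambda>r. escape_rate M T (ball x r) / ereal (?b r)) \<longlongrightarrow> ereal (1 - \<theta>)) (at 0 within ?S)"
    by (rule Lim_transform_eventually)
  with inf sup show ?thesis unfolding has_localised_escape_rate_def by blast
qed

end

text \<open>The asymptotic bound holds from some index \<open>k0\<close> on; monotonicity covers the finitely many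
  indices before it at the cost of a larger constant.\<close>

lemma quadratic_decay_bound:
  fixes \<phi> :: "nat \<Rightarrow> real"
  assumes dec: "decseq \<phi>" and O: "\<phi> \<in> O(\<lambda>k. real k powr (- p))" and p: "p > 2"
  shows "\<exists>C. \<forall>k\<ge>1. \<phi> k \<le> C / (real k)\<^sup>2"
proof -
  obtain c where "eventually (\<lambda>k. norm (\<phi> k) \<le> c * norm (real k powr (- p))) sequentially" and c: "c > 0"
    using O by (elim landau_o.bigE) auto
  then obtain k0 where k0: "\<And>k. k \<ge> k0 \<Longrightarrow> \<bar>\<phi> k\<bar> \<le> c * real k powr (- p)"
    unfolding eventually_sequentially by auto
  have "\<phi> k \<le> (c + \<bar>\<phi> 0\<bar> * (real k0)\<^sup>2) / (real k)\<^sup>2" if k: "k \<ge> 1" for k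
  proof (cases "k \<ge> k0")
    case True
    have "\<phi> k \<le> c * real k powr (- p)" using k0[OF True] by simp
    also have "\<dots> \<le> c * real k powr (- 2)" using k p c by (intro mult_left_mono powr_mono) auto
    also have "\<dots> = c / (real k)\<^sup>2" using k by (simp add: powr_minus powr_numeral divide_inverse)
    also have "\<dots> \<le> (c + \<bar>\<phi> 0\<bar> * (real k0)\<^sup>2) / (real k)\<^sup>2" by (intro divide_right_mono) auto
    finally show ?thesis .
  next
    case False
    have "\<phi> k * (real k)\<^sup>2 \<le> \<bar>\<phi> 0\<bar> * (real k)\<^sup>2"
      using decseqD[OF dec, of 0 k] by (intro mult_right_mono) auto
    also have "\<dots> \<le> \<bar>\<phi> 0\<bar> * (real k0)\<^sup>2" using False by (intro mult_left_mono power_mono) auto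
    also have "\<dots> \<le> c + \<bar>\<phi> 0\<bar> * (real k0)\<^sup>2" using c by simp
    finally show ?thesis using k by (simp add: pos_le_divide_eq)
  qed
  then show ?thesis by blast
qed

theorem theorem2:
  fixes charts :: "('a::{metric_space,second_countable_topology}, 'b::euclidean_space) chart set"
    and g :: "('a, 'b) chart \<Rightarrow> 'a \<Rightarrow> 'b \<Rightarrow> 'b \<Rightarrow> real"
    and T :: "'a \<Rightarrow> 'a"
    and M :: "'a measure"
    and P :: "'a set set"
    and \<phi> :: "nat \<Rightarrow> real"
    and \<alpha> p \<kappa> w d \<zeta> :: real
  assumes manifold: "riemannian_manifold charts g"
    and map: "0 < \<alpha>" "\<alpha> \<le> 1" "C1_holder_map charts \<alpha> T"
    and invariant: "invariant_prob M T"
    and generating: "generating_partition M T P"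
    and mixing: "right_phi_mixing M T P \<phi>" "\<phi> \<in> O(\<lambda>k. real k powr (- p))"
    and diam: "\<kappa> > 0"
      "\<exists>C. \<forall>\<^sub>F n in sequentially. cylinders_diam T P n \<le> ennreal (C * real n powr (- \<kappa>))"
    and annulus: "w > 1"
      "\<And>x. ((\<lambda>r. measure M (ball x (r + r powr w)) / measure M (ball x r)) \<longlongrightarrow> 1) (at_right 0)"
    and ball_measure: "d > 0"
      "\<exists>C. \<exists>r\<^sub>0>0. \<forall>r. 0 < r \<and> r < r\<^sub>0 \<longrightarrow> (\<forall>x. measure M (ball x r) \<le> C * r powr d)"
    and exponents: "\<kappa> * d / w > 1"
    and zeta: "0 < \<zeta>" "\<zeta> \<le> 1"
    and inner: "\<And>x. periodic_overlap_property M T x \<zeta> (approx_order \<kappa> w)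
      (\<lambda>r. inner_approx T P (approx_order \<kappa> w r) x r)"
    and outer: "\<And>x. periodic_overlap_property M T x \<zeta> (approx_order \<kappa> w)
      (\<lambda>r. outer_approx T P (approx_order \<kappa> w r) x r)"
    and power: "p > max ((2 - \<zeta>) / \<zeta>) 2"
  shows "\<forall>x.
    ((\<nexists>m. minimal_period T x m) \<longrightarrow> has_localised_escape_rate M T x 1) \<and>
    (\<forall>m \<theta>. minimal_period T x m \<and>
       ((\<lambda>r. measure M ((T ^^ m) -` ball x r \<inter> ball x r) / measure M (ball x r)) \<longlongrightarrow> \<theta>)
         (at_right 0) \<and>
       \<theta> < 1 / 2 \<longrightarrow>
       has_localised_escape_rate M T x (1 - \<theta>))"
proof -
  have "decseq \<phi>" using mixing(1) by (simp add: right_phi_mixing_def)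
  then have phi: "\<exists>C. \<forall>k\<ge>1. \<phi> k \<le> C / (real k)\<^sup>2"
    using mixing(2) by (rule quadratic_decay_bound) (use power in simp)
  have continuous: "continuous_on UNIV T" using map(3) by (simp add: C1_holder_map_def)
  interpret polynomial_system M T P \<phi> \<kappa> w d
    using invariant generating mixing(1) continuous diam annulus ball_measure exponents phi
    by unfold_locales (auto simp: generating_partition_def)
  show ?thesis
  proof (intro allI conjI impI)
    fix x assume nonper: "\<nexists>m. minimal_period T x m"
    have aper: "(T ^^ j) x \<noteq> x" if "j \<ge> 1" for j
    proof
      assume "(T ^^ j) x = x"
      with that have "0 < j \<and> (T ^^ j) x = x" by simp
      then have "minimal_period T x (LEAST j. 0 < j \<and> (T ^^ j) x = x)"
        unfolding minimal_period_def by (smt (verit) LeastI not_less_Least)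
      with nonper show False by blast
    qed
    have "eventually (\<lambda>r::real. ball x r \<subseteq> ball x (2 * r)) (at_right 0)"
      using eventually_at_right_less[of 0] by eventually_elim (intro subset_ball, simp)
    then have "((\<lambda>r. prob (ball x r \<inter> (T ^^ 1) -` ball x r - {}) / prob (ball x r)) \<longlongrightarrow> 0) (at_right 0)"
      by (rule short_returns_nonrecurrent) (use aper[of 1] in simp)
    then have ret: "((\<lambda>r. prob (ball x r \<inter> (T ^^ 1) -` ball x r) / prob (ball x r)) \<longlongrightarrow> 0) (at_right 0)"
      by simp
    have "has_localised_escape_rate M T x (1 - 0)"
    proof (rule has_localised_escape_rate_of_short_returns[OF order_refl ret])
      fix j :: nat and U :: "real \<Rightarrow> 'a set"
      assume "j \<ge> 1" and sub: "eventually (\<lambda>r. U r \<subseteq> ball x (2 * r)) (at_right 0)"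
      then show "((\<lambda>r. prob (U r \<inter> (T ^^ j) -` U r - (T ^^ 1) -` U r) / prob (U r)) \<longlongrightarrow> 0) (at_right 0)"
        by (intro short_returns_nonrecurrent[OF sub] aper)
    qed
    then show "has_localised_escape_rate M T x 1" by simp
  next
    fix x m \<theta>
    assume "minimal_period T x m \<and>
       ((\<lambda>r. prob ((T ^^ m) -` ball x r \<inter> ball x r) / prob (ball x r)) \<longlongrightarrow> \<theta>) (at_right 0) \<and> \<theta> < 1 / 2"
    then have per: "minimal_period T x m"
      and ret: "((\<lambda>r. prob (ball x r \<inter> (T ^^ m) -` ball x r) / prob (ball x r)) \<longlongrightarrow> \<theta>) (at_right 0)"
      by (simp_all add: Int_commute)
    show "has_localised_escape_rate M T x (1 - \<theta>)"
    proof (rule has_localised_escape_rate_of_short_returns[OF _ ret])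
      show "m \<ge> 1" using per by (simp add: minimal_period_def Suc_le_eq)
      fix j :: nat and U :: "real \<Rightarrow> 'a set"
      assume j: "j \<ge> 1" and sub: "eventually (\<lambda>r. U r \<subseteq> ball x (2 * r)) (at_right 0)"
        and "U = (\<lambda>r. inner_approx T P (approx_order \<kappa> w r) x r) \<or> U = (\<lambda>r. outer_approx T P (approx_order \<kappa> w r) x r)"
      then have "observable T P (approx_order \<kappa> w r) (U r)" "periodic_overlap_property M T x \<zeta> (approx_order \<kappa> w) U" for r
        using inner outer observable_inner_approx observable_cylinder_hull
        by (auto simp: outer_approx_eq_cylinder_hull[abs_def])
      then show "((\<lambda>r. prob (U r \<inter> (T ^^ j) -` U r - (T ^^ m) -` U r) / prob (U r)) \<longlongrightarrow> 0) (at_right 0)"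
        by (intro short_returns_periodic[OF _ sub per zeta(1) _ j])
    qed
  qed
qed

end
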